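(* Let $\{v^{n}\}_{n=0}^{N}$, $\{\xi^{n}\}_{n=1}^{N}$, $\{\eta^{n}\}_{n=1}^{N}$ and $\{\zeta^{n}\}_{n=1}^{N}$ be non-negative finite sequences such that $$D_{t_n}^{\alpha}(v^{n})^2 \le \sum_{i=0}^{n}\lambda_{n-i}^{n}(v^{i})^{2} + v^{n}\xi^{n} + (\eta^{n})^{2} + (\zeta^{n})^{2},\qquad 1\leq n \leq N,$$ where $\lambda_{j}^{n}\ge 0$ for $0\leq j\leq n$. If there exists a constant $\Lambda>0$ such that $\sum_{j=0}^{n}\lambda_{j}^{n}\le\Lambda$ for $1\leq n \leq N$, and if $\Delta t_{n-1}\leq\Delta t_{n}$ for $2\leq n \leq N$, with the maximum time-step size satisfying $$\Delta t:=\max_{1\leq n \leq N} \Delta t_{n}\le \Big(\delta\,\Gamma(2-\alpha)\max_{1\leq n \leq N}\lambda_0^n\Big)^{-1/\alpha}\quad\text{for some } \delta>1,$$ then, for $1\leq n \leq N$, $$v^{n} \leq C_\delta E_{\alpha}\left(C_\delta\Lambda_{n} t_{n}^{\alpha}\right)\left( v^0 + \max_{1\leq j\leq n}\sum_{i=1}^{j} P^{j,i}_{\alpha}\, \xi^i + \left(2 t_n^{\alpha} \right)^{1/2}\max_{1 \leq j \leq n}\eta^j + \max_{1\leq j\leq n} \Big(\sum_{i=1}^{j} P^{j,i}_{\alpha} (\zeta^i)^2\Big)^{1/2} \right),$$ where $C_\delta:=\frac{\delta}{\delta-1}$ and, with $n_\alpha:=\min\left(\lfloor 1/\alpha\rfloor,N\right)$,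 $$\Lambda_n:=\begin{cases}\Lambda, & 1\leq n \leq n_\alpha,\\ \Lambda\Big(1+\max\limits_{n_\alpha +1\leq j \leq n}\dfrac{P_\alpha^{j,j}}{P_\alpha^{j,j-1}}\Big), & n_\alpha + 1\leq n \leq N.\end{cases}$$ Moreover $\Lambda_n\le \Lambda\big(1+ \max_{n_\alpha +1\leq j \leq n} \mu_j^\alpha/\alpha\big)$, where $\mu_n:=\Delta t_n/\Delta t_{n-1}$.
   Context: Let $0<\alpha<1$, $0<T<\infty$, and let $0=t_0<t_1<\dots<t_N=T$ be a partition of $[0,T]$ with $\Delta t_j=t_j-t_{j-1}$. For $\beta>0$ put $k_\beta(t)=t^{\beta-1}/\Gamma(\beta)$, $t>0$. The discrete kernels are $$K_{1-\alpha}^{n,j}=\frac1{\Delta t_j}\int_{t_{j-1}}^{t_j}k_{1-\alpha}(t_n-s)\,ds,\qquad 1\le j\le n\le N,$$ and the L1 discrete fractional differential operator acts on sequences by $D_{t_n}^\alpha\phi^n=\sum_{j=1}^nK_{1-\alpha}^{n,j}(\phi^j-\phi^{j-1})$. In particular $D_{t_n}^\alpha (v^n)^2=\sum_{j=1}^nK_{1-\alpha}^{n,j}\big((v^j)^2-(v^{j-1})^2\big)$. The complementary discrete kernels $P_\alpha^{n,i}$, $1\le i\le n$, are defined recursively (for $i=n,n-1,\dots,1$) by $$P_\alpha^{n,n}=\frac1{K_{1-\alpha}^{n,n}},\qquad P_\alpha^{n,i}=\frac1{K_{1-\alpha}^{i,i}}\sum_{j=i+1}^nP_\alpha^{n,j}\big(K_{1-\alpha}^{j,i+1}-K_{1-\alpha}^{j,i}\big)\quad(1\le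 i\le n-1).$$ $E_\alpha(z)=\sum_{j=0}^\infty z^j/\Gamma(j\alpha+1)$ is the Mittag-Leffler function. Conventions: if $\max_n\lambda_0^n=0$ the time-step condition is void; a maximum over an empty index set is $0$. *)

theory Defs
  imports "HOL-Analysis.Analysis"
begin

definition tgrid :: "(nat \<Rightarrow> real) \<Rightarrow> nat \<Rightarrow> real \<Rightarrow> bool" where
  "tgrid t N T \<longleftrightarrow> t 0 = 0 \<and> t N = T \<and> (\<forall>n\<in>{1..N}. t (n - 1) < t n)"

definition tstep :: "(nat \<Rightarrow> real) \<Rightarrow> nat \<Rightarrow> real" where
  "tstep t n = t n - t (n - 1)"

definition kfrac :: "real \<Rightarrow> real \<Rightarrow> real" where
  "kfrac \<beta> x = x powr (\<beta> - 1) / Gamma \<beta>"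

text \<open>For \<open>j = n\<close> the integrand is singular at \<open>s = t n\<close>; its value there is irrelevant.\<close>
definition Kker :: "real \<Rightarrow> (nat \<Rightarrow> real) \<Rightarrow> nat \<Rightarrow> nat \<Rightarrow> real" where
  "Kker \<alpha> t n j = 1 / tstep t j * integral {t (j - 1)..t j} (\<lambda>s. kfrac (1 - \<alpha>) (t n - s))"

definition L1_deriv :: "real \<Rightarrow> (nat \<Rightarrow> real) \<Rightarrow> (nat \<Rightarrow> real) \<Rightarrow> nat \<Rightarrow> real" where
  "L1_deriv \<alpha> t \<phi> n = (\<Sum>j=1..n. Kker \<alpha> t n j * (\<phi> j - \<phi> (j - 1)))"

text \<open>Complementary kernels, by downward recursion on the second index;
  only the indices \<open>1 \<le> i \<le> n\<close> are meaningful.\<close>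
function Pker :: "real \<Rightarrow> (nat \<Rightarrow> real) \<Rightarrow> nat \<Rightarrow> nat \<Rightarrow> real" where
  "Pker \<alpha> t n i =
     (if i = n then 1 / Kker \<alpha> t n n
      else 1 / Kker \<alpha> t i i *
        (\<Sum>j=i+1..n. Pker \<alpha> t n j * (Kker \<alpha> t j (i + 1) - Kker \<alpha> t j i)))"
  by auto
termination
  by (relation "Wellfounded.measure (\<lambda>(\<alpha>, t, n, i). n - i)") auto

declare Pker.simps [simp del]

definition mittag_leffler :: "real \<Rightarrow> real \<Rightarrow> real" where
  "mittag_leffler \<alpha> z = (\<Sum>j. z ^ j / Gamma (real j * \<alpha> + 1))"

text \<open>Maximum over a finite index set, with the maximum over the empty set taken to be 0.\<close>
definition max_over :: "nat set \<Rightarrow> (nat \<Rightarrow> real) \<Rightarrow> real" where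
  "max_over A f = (if A = {} then 0 else (MAX j\<in>A. f j))"

definition n_alpha :: "real \<Rightarrow> nat \<Rightarrow> nat" where
  "n_alpha \<alpha> N = min (nat \<lfloor>1 / \<alpha>\<rfloor>) N"

definition Lambda_n :: "real \<Rightarrow> (nat \<Rightarrow> real) \<Rightarrow> nat \<Rightarrow> real \<Rightarrow> nat \<Rightarrow> real" where
  "Lambda_n \<alpha> t N \<Lambda> n =
     (if n \<le> n_alpha \<alpha> N then \<Lambda>
      else \<Lambda> * (1 + max_over {n_alpha \<alpha> N + 1..n} (\<lambda>j. Pker \<alpha> t j j / Pker \<alpha> t j (j - 1))))"

definition mu :: "(nat \<Rightarrow> real) \<Rightarrow> nat \<Rightarrow> real" where
  "mu t n = tstep t n / tstep t (n - 1)"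

definition C_delta :: "real \<Rightarrow> real" where
  "C_delta \<delta> = \<delta> / (\<delta> - 1)"

end

theory Submission
  imports Defs
begin

text \<open>
  The complementary kernels invert the L1 operator: \<open>(\<Sum>j=m..n. P n j * K j m) = 1\<close>
  (\<open>sum_P_K\<close>), so weighting the assumed inequality at the levels \<open>1..n\<close> with \<open>P n j\<close> and
  summing leaves \<open>(v n)\<^sup>2 - (v 0)\<^sup>2\<close> on the left. If \<open>v n\<close> is at most an earlier value, or at
  most the bracket of data on the right of the claim, the claim is immediate. Otherwise every
  quadratic term contains a factor that is at most \<open>v n\<close>; cancelling one such factor leaves an
  inequality that is linear in \<open>v\<close> (\<open>linearised_inequality\<close>). The step size condition says
  \<open>P n n * lam n 0 \<le> 1 / \<delta>\<close>, so the implicit term \<open>lam n 0 * v n\<close> is absorbed into the left hand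
  side at the price of the factor \<open>C_delta \<delta>\<close> (\<open>gronwall_step\<close>).

  It remains to see that the Mittag-Leffler function dominates the linear recursion. The power
  \<open>kfrac (1 + \<beta> - \<alpha>)\<close> is the convolution of \<open>kfrac (1 - \<alpha>)\<close> with \<open>kfrac \<beta>\<close>, the derivative of
  \<open>kfrac (1 + \<beta>)\<close>: it is the Caputo derivative of \<open>kfrac (1 + \<beta>)\<close>. It is compared with the L1
  approximation of this derivative interval by interval. For \<open>\<beta> \<le> 1\<close> one factor increases and the other decreases,
  Chebyshev's inequality applies, and the discrete fractional integral of the one power is at most
  the other power (\<open>sum_P_kfrac_concave\<close>). For \<open>\<beta> \<ge> 1\<close> the increments of the power grow, so that
  each interval is compared with the following one, which is at least as long; this costs the
  summand \<open>j = n\<close> (\<open>sum_P_kfrac_convex\<close>). Summation over the power series yields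
  \<open>sum_P_mittag_leffler\<close>, again without the summand \<open>j = n\<close>.

  The two cases of \<open>Lambda_n\<close> are two ways to recover that summand, in which only \<open>v 0, ..., v (n - 1)\<close>
  occur once the implicit term has been absorbed. In general, bounding its weight \<open>P n n\<close> by a multiple
  of \<open>P n (n - 1)\<close> merges it with the summand \<open>j = n - 1\<close>, whence the factor
  \<open>1 + P n n / P n (n - 1)\<close>. While \<open>n \<le> 1 / \<alpha>\<close>, the iteration has only produced a polynomial of
  degree \<open>n\<close> in \<open>\<Lambda>\<close>, and the powers of \<open>t\<close> in it have exponents at most \<open>n * \<alpha> \<le> 1\<close>, so the concave case
  with its full sum suffices (\<open>discrete_gronwall_early\<close>).
\<close>

section \<open>Growth of the Gamma function and the Mittag-Leffler series\<close>

lemma pos_notin_nonpos_Ints: "0 < (x :: real) \<Longrightarrow> x \<notin> \<int>\<^sub>\<le>\<^sub>0"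
  by auto

text \<open>
  By log-convexity, the mean slope of \<open>ln \<circ> Gamma\<close> on \<open>[x, x + a]\<close> is at least that on
  \<open>[x - 1, x]\<close>, which equals \<open>ln (x - 1)\<close> by the functional equation.
\<close>
lemma Gamma_shift_ge:
  fixes x a :: real
  assumes x: "1 < x" and a: "0 < a"
  shows "(x - 1) powr a * Gamma x \<le> Gamma (x + a)"
proof -
  let ?u = "1 / (1 + a)"
  have "ln (Gamma ((1 - ?u) *\<^sub>R (x - 1) + ?u *\<^sub>R (x + a)))
      \<le> (1 - ?u) * ln (Gamma (x - 1)) + ?u * ln (Gamma (x + a))"
    using convex_onD[OF log_convex_Gamma_real, of ?u "x - 1" "x + a"] assms by (auto simp: field_simps)
  also have "(1 - ?u) *\<^sub>R (x - 1) + ?u *\<^sub>R (x + a) = x"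
  proof -
    have "(1 - w) *\<^sub>R (x - 1) + w *\<^sub>R (x + a) = x - 1 + w * (1 + a)" for w
      by (simp add: algebra_simps)
    from this[of ?u] show ?thesis using a by simp
  qed
  finally have "(1 + a) * ln (Gamma x) \<le> (1 + a) * ((1 - ?u) * ln (Gamma (x - 1)) + ?u * ln (Gamma (x + a)))"
    using a by (intro mult_left_mono) auto
  also have "\<dots> = ((1 + a) - (1 + a) * ?u) * ln (Gamma (x - 1)) + (1 + a) * ?u * ln (Gamma (x + a))"
    by (simp only: algebra_simps)
  also have "(1 + a) * ?u = 1"
    using a by simp
  finally have "(1 + a) * ln (Gamma x) \<le> a * ln (Gamma (x - 1)) + ln (Gamma (x + a))"
    by simp
  moreover have "Gamma x = (x - 1) * Gamma (x - 1)"
    using Gamma_plus1[of "x - 1", OF pos_notin_nonpos_Ints] x by simp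
  then have "ln (Gamma x) = ln (x - 1) + ln (Gamma (x - 1))"
    using x Gamma_real_pos[of "x - 1"] by (metis ln_mult_pos diff_gt_0_iff_gt)
  ultimately have "a * ln (x - 1) + ln (Gamma x) \<le> ln (Gamma (x + a))"
    by (simp add: algebra_simps)
  moreover have "ln ((x - 1) powr a * Gamma x) = a * ln (x - 1) + ln (Gamma x)"
    using x Gamma_real_pos[of x] by (simp add: ln_mult_pos ln_powr)
  ultimately show ?thesis
    using x a by (subst ln_le_cancel_iff[symmetric]) (auto simp: Gamma_real_pos)
qed

lemma Gamma_1_plus_ge_half:
  fixes a :: real
  assumes "0 < a" "a \<le> 1"
  shows "1 / 2 \<le> Gamma (1 + a)"
proof -
  have "1 \<le> Gamma (2 + a)"
    using Gamma_shift_ge[of 2 a] assms by (simp add: Gamma_numeral)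
  also have "Gamma (2 + a) = (1 + a) * Gamma (1 + a)"
    using Gamma_plus1[of "1 + a", OF pos_notin_nonpos_Ints] assms by (simp add: algebra_simps)
  also have "\<dots> \<le> 2 * Gamma (1 + a)"
    using assms by (intro mult_right_mono) auto
  finally show ?thesis by simp
qed

lemma Gamma_1_plus:
  fixes b :: real
  assumes "0 < b"
  shows "Gamma (1 + b) = b * Gamma b"
  using Gamma_plus1[of b, OF pos_notin_nonpos_Ints] assms by (simp add: algebra_simps)

text \<open>
  Consecutive Gamma factors have a quotient of at least \<open>(n * a) powr a\<close>, which is unbounded; hence the
  ratio test applies for every \<open>z\<close>.
\<close>
lemma summable_mittag_leffler:
  fixes a z :: real
  assumes a: "0 < a"
  shows "summable (\<lambda>j. z ^ j / Gamma (real j * a + 1))"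
proof -
  \<comment> \<open>From this index on the ratio of consecutive terms is at most one half.\<close>
  define M where "M = nat \<lceil>(2 * \<bar>z\<bar>) powr (1 / a) / a\<rceil>"
  have M: "2 * \<bar>z\<bar> \<le> (real n * a) powr a" if "M \<le> n" for n
  proof -
    have "(2 * \<bar>z\<bar>) powr (1 / a) / a \<le> real n"
      using that unfolding M_def by linarith
    then have "((2 * \<bar>z\<bar>) powr (1 / a)) powr a \<le> (real n * a) powr a"
      using a by (intro powr_mono2) (auto simp: field_simps)
    then show ?thesis
      using a by (simp add: powr_powr)
  qed
  show ?thesis
  proof (rule summable_ratio_test[where c = "1/2" and N = "max 1 M"])
    fix n assume n: "max 1 M \<le> n"
    let ?x = "real n * a + 1"
    have G: "0 < Gamma ?x" "0 < Gamma (?x + a)"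
      using a by (auto intro!: Gamma_real_pos add_nonneg_pos)
    have "2 * \<bar>z\<bar> * Gamma ?x \<le> (?x - 1) powr a * Gamma ?x"
      using M[of n] n G by (intro mult_right_mono) auto
    also have "\<dots> \<le> Gamma (?x + a)"
      using Gamma_shift_ge[of ?x a] n a by simp
    finally have "\<bar>z\<bar> / Gamma (?x + a) \<le> 1 / 2 * (1 / Gamma ?x)"
      using G by (simp add: field_simps)
    then have "\<bar>z\<bar> ^ n * (\<bar>z\<bar> / Gamma (?x + a)) \<le> \<bar>z\<bar> ^ n * (1 / 2 * (1 / Gamma ?x))"
      by (rule mult_left_mono) simp
    moreover have "real (Suc n) * a + 1 = ?x + a" by (simp add: algebra_simps)
    ultimately show "norm (z ^ Suc n / Gamma (real (Suc n) * a + 1)) \<le> 1 / 2 * norm (z ^ n / Gamma ?x)"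
      using G by (simp add: abs_mult power_abs field_simps)
  qed simp
qed

section \<open>Riemann-Liouville kernels\<close>

lemma kfrac_pos: "0 < \<beta> \<Longrightarrow> 0 < x \<Longrightarrow> 0 < kfrac \<beta> x"
  by (simp add: kfrac_def Gamma_real_pos)

lemma kfrac_nonneg: "0 < \<beta> \<Longrightarrow> 0 \<le> kfrac \<beta> x"
  using Gamma_real_pos[of \<beta>] by (simp add: kfrac_def)

lemma kfrac_strict_antimono:
  "0 < \<beta> \<Longrightarrow> \<beta> < 1 \<Longrightarrow> 0 < x \<Longrightarrow> x < y \<Longrightarrow> kfrac \<beta> y < kfrac \<beta> x"
  unfolding kfrac_def by (intro divide_strict_right_mono powr_less_mono2_neg Gamma_real_pos) auto

lemma kfrac_antimono:
  "0 < \<beta> \<Longrightarrow> \<beta> \<le> 1 \<Longrightarrow> 0 < x \<Longrightarrow> x \<le> y \<Longrightarrow> kfrac \<beta> y \<le> kfrac \<beta> x"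
  unfolding kfrac_def by (intro divide_right_mono powr_mono2' less_imp_le[OF Gamma_real_pos]) auto

lemma kfrac_mono:
  "1 \<le> \<beta> \<Longrightarrow> 0 \<le> x \<Longrightarrow> x \<le> y \<Longrightarrow> kfrac \<beta> x \<le> kfrac \<beta> y"
  unfolding kfrac_def by (intro divide_right_mono powr_mono2 less_imp_le[OF Gamma_real_pos]) auto

lemma has_derivative_kfrac:
  assumes "0 < \<beta>" "0 < x"
  shows "(kfrac (1 + \<beta>) has_real_derivative kfrac \<beta> x) (at x)"
proof -
  have "((\<lambda>x. x powr \<beta> / Gamma (1 + \<beta>)) has_real_derivative \<beta> * x powr (\<beta> - 1) / Gamma (1 + \<beta>)) (at x)"
    by (intro DERIV_cdivide has_real_derivative_powr assms)
  then show ?thesis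
    using assms by (simp add: kfrac_def[abs_def] Gamma_1_plus)
qed

lemma continuous_on_kfrac: "0 < \<beta> \<Longrightarrow> continuous_on {0..} (kfrac (1 + \<beta>))"
  unfolding kfrac_def[abs_def]
  by (intro continuous_intros continuous_on_powr') (auto simp: Gamma_eq_zero_iff elim!: nonpos_Ints_cases)

lemma
  assumes "0 < \<beta>" "a < b" "b \<le> c"
  shows has_integral_kfrac_reflected:
      "((\<lambda>s. kfrac \<beta> (c - s)) has_integral kfrac (1 + \<beta>) (c - a) - kfrac (1 + \<beta>) (c - b)) {a..b}"
    and kfrac_reflected_mvt:
      "\<exists>s\<in>{a<..<b}. kfrac (1 + \<beta>) (c - a) - kfrac (1 + \<beta>) (c - b) = (b - a) * kfrac \<beta> (c - s)"
proof -
  let ?F = "\<lambda>s. - kfrac (1 + \<beta>) (c - s)"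
  have cont: "continuous_on {a..b} ?F"
    by (intro continuous_intros continuous_on_compose2[OF continuous_on_kfrac[OF assms(1)]])
       (use assms in auto)
  have der: "(?F has_real_derivative kfrac \<beta> (c - s)) (at s)" if "a < s" "s < b" for s
  proof -
    have "((\<lambda>s. kfrac (1 + \<beta>) (c - s)) has_real_derivative kfrac \<beta> (c - s) * (- 1)) (at s)"
      by (rule DERIV_chain2[OF has_derivative_kfrac])
         (use assms that in \<open>auto intro!: derivative_eq_intros\<close>)
    from DERIV_minus[OF this] show ?thesis by simp
  qed
  show "((\<lambda>s. kfrac \<beta> (c - s)) has_integral kfrac (1 + \<beta>) (c - a) - kfrac (1 + \<beta>) (c - b)) {a..b}"
    using fundamental_theorem_of_calculus_interior[of a b ?F "\<lambda>s. kfrac \<beta> (c - s)"] assms cont der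
    by (auto simp: has_real_derivative_iff_has_vector_derivative)
  show "\<exists>s\<in>{a<..<b}. kfrac (1 + \<beta>) (c - a) - kfrac (1 + \<beta>) (c - b) = (b - a) * kfrac \<beta> (c - s)"
  proof (rule mvt[OF assms(2) cont])
    show "(?F has_derivative (*) (kfrac \<beta> (c - s))) (at s)" if "a < s" "s < b" for s
      using der[OF that] by (simp add: has_field_derivative_def)
    show ?thesis if "a < s" "s < b" "?F b - ?F a = kfrac \<beta> (c - s) * (b - a)" for s
      using that by (intro bexI[of _ s]) (auto simp: mult.commute)
  qed
qed

lemma has_integral_kfrac:
  assumes "0 < \<beta>" "0 \<le> a" "a < b"
  shows "(kfrac \<beta> has_integral kfrac (1 + \<beta>) b - kfrac (1 + \<beta>) a) {a..b}"
  by (rule fundamental_theorem_of_calculus_interior)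
     (use assms in \<open>auto intro!: continuous_on_subset[OF continuous_on_kfrac] has_derivative_kfrac
        simp: has_real_derivative_iff_has_vector_derivative[symmetric]\<close>)

text \<open>
  The semigroup property of fractional integration: Euler's Beta integral, stretched from
  \<open>[0, 1]\<close> to \<open>[0, c]\<close>.
\<close>
lemma has_integral_kfrac_convolution:
  assumes b: "0 < \<beta>" and g: "0 < \<gamma>" and c: "0 < c"
  shows "((\<lambda>s. kfrac \<beta> (c - s) * kfrac \<gamma> s) has_integral kfrac (\<beta> + \<gamma>) c) {0..c}"
proof -
  have img: "(\<lambda>x. x / (1 / c)) ` {0..1} = {0..c}"
  proof (intro equalityI subsetI)
    fix x assume "x \<in> {0..c}"
    then show "x \<in> (\<lambda>x. x / (1 / c)) ` {0..1}"
      using c by (intro image_eqI[of _ _ "x / c"]) (auto simp: field_simps)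
  qed (use c in \<open>auto simp: field_simps\<close>)
  have "((\<lambda>s. (1 / c * s) powr (\<gamma> - 1) * (1 - 1 / c * s) powr (\<beta> - 1)) has_integral c * Beta \<gamma> \<beta>) {0..c}"
    using has_integral_stretch_real[OF has_integral_Beta_real[OF g b], of "1 / c"] c
    unfolding img by simp
  from has_integral_mult_right[OF this, of "c powr (\<beta> + \<gamma> - 2) / (Gamma \<beta> * Gamma \<gamma>)"]
  have "((\<lambda>s. c powr (\<beta> + \<gamma> - 2) / (Gamma \<beta> * Gamma \<gamma>) * ((1 / c * s) powr (\<gamma> - 1) * (1 - 1 / c * s) powr (\<beta> - 1)))
     has_integral kfrac (\<beta> + \<gamma>) c) {0..c}" (is "(?f has_integral ?I) _")
  proof (rule back_subst[where P = "\<lambda>I. (_ has_integral I) _"])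
    have "c powr (\<beta> + \<gamma> - 2) * c = c powr (\<beta> + \<gamma> - 1)"
      using powr_add[of c "\<beta> + \<gamma> - 2" 1] c by simp
    then show "c powr (\<beta> + \<gamma> - 2) / (Gamma \<beta> * Gamma \<gamma>) * (c * Beta \<gamma> \<beta>) = kfrac (\<beta> + \<gamma>) c"
      using Gamma_real_pos[OF b] Gamma_real_pos[OF g]
      by (simp add: Beta_def kfrac_def field_simps)
  qed
  then show ?thesis
  proof (rule has_integral_eq[rotated])
    fix s assume s: "s \<in> {0..c}"
    have "1 - s / c = (c - s) / c" using c by (simp add: field_simps)
    then have "(s / c) powr (\<gamma> - 1) * (1 - s / c) powr (\<beta> - 1)
       = s powr (\<gamma> - 1) * (c - s) powr (\<beta> - 1) / (c powr (\<gamma> - 1) * c powr (\<beta> - 1))"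
      using s c by (simp add: powr_divide)
    also have "c powr (\<gamma> - 1) * c powr (\<beta> - 1) = c powr (\<beta> + \<gamma> - 2)"
      by (simp add: powr_add[symmetric] algebra_simps)
    finally show "?f s = kfrac \<beta> (c - s) * kfrac \<gamma> s"
      using c by (simp add: kfrac_def field_simps)
  qed
qed

text \<open>
  Chebyshev's integral inequality for an increasing and a decreasing factor. The mean value \<open>m\<close> of
  \<open>kfrac \<gamma> (c - s)\<close> is attained at some interior point \<open>r\<close>. The product of
  \<open>kfrac \<gamma> (c - s) - m\<close> and \<open>kfrac \<beta> s - kfrac \<beta> r\<close> is never positive, because both factors change
  sign at \<open>r\<close>, in opposite directions. Since \<open>kfrac \<gamma> (c - s) - m\<close> has integral zero, the product
  has integral \<open>I\<close> minus the claimed bound.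
\<close>
lemma chebyshev_kfrac:
  assumes ab: "0 \<le> a" "a < b" "b \<le> c"
    and \<gamma>: "0 < \<gamma>" "\<gamma> \<le> 1" and \<beta>: "0 < \<beta>" "\<beta> \<le> 1"
    and int: "((\<lambda>s. kfrac \<gamma> (c - s) * kfrac \<beta> s) has_integral I) {a..b}"
  shows "I \<le> (kfrac (1 + \<gamma>) (c - a) - kfrac (1 + \<gamma>) (c - b)) / (b - a)
              * (kfrac (1 + \<beta>) b - kfrac (1 + \<beta>) a)"
proof -
  let ?G = "kfrac (1 + \<gamma>) (c - a) - kfrac (1 + \<gamma>) (c - b)"
  let ?H = "kfrac (1 + \<beta>) b - kfrac (1 + \<beta>) a"
  obtain r where r: "a < r" "r < b" and G: "?G = (b - a) * kfrac \<gamma> (c - r)"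
    using kfrac_reflected_mvt[OF \<gamma>(1) ab(2,3)] by auto
  have "((\<lambda>s. kfrac \<gamma> (c - s) * kfrac \<beta> s - kfrac \<gamma> (c - r) * kfrac \<beta> s
        - kfrac \<gamma> (c - s) * kfrac \<beta> r + kfrac \<gamma> (c - r) * kfrac \<beta> r)
      has_integral I - kfrac \<gamma> (c - r) * ?H - ?G * kfrac \<beta> r
        + (b - a) * (kfrac \<gamma> (c - r) * kfrac \<beta> r)) {a..b}"
    using has_integral_const_real[of "kfrac \<gamma> (c - r) * kfrac \<beta> r" a b] ab
    by (intro has_integral_add has_integral_diff int has_integral_mult_right has_integral_mult_left
         has_integral_kfrac has_integral_kfrac_reflected \<gamma> \<beta>) (simp_all)
  then have "((\<lambda>s. (kfrac \<gamma> (c - s) - kfrac \<gamma> (c - r)) * (kfrac \<beta> s - kfrac \<beta> r))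
      has_integral I - kfrac \<gamma> (c - r) * ?H) {a..b}"
    unfolding G by (simp add: algebra_simps)
  then have "I - kfrac \<gamma> (c - r) * ?H \<le> 0"
    \<comment> \<open>At the end points the kernels may be singular, and monotonicity may fail for their default value 0 there.\<close>
    unfolding has_integral_Icc_iff_Ioo
  proof (rule has_integral_le[OF _ has_integral_0])
    fix s assume s: "s \<in> {a<..<b}"
    show "(kfrac \<gamma> (c - s) - kfrac \<gamma> (c - r)) * (kfrac \<beta> s - kfrac \<beta> r) \<le> 0"
    proof (cases "s \<le> r")
      case True
      then show ?thesis
        using s r ab kfrac_antimono[OF \<gamma>, of "c - r" "c - s"] kfrac_antimono[OF \<beta>, of s r]
        by (intro mult_nonpos_nonneg) auto
    next
      case False
      then show ?thesis
        using s r ab kfrac_antimono[OF \<gamma>, of "c - s" "c - r"] kfrac_antimono[OF \<beta>, of r s]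
        by (intro mult_nonneg_nonpos) auto
    qed
  qed
  then show ?thesis
    using G ab by simp
qed

lemma convolution_le_right_endpoint:
  assumes ab: "0 \<le> a" "a < b" "b \<le> c" and \<gamma>: "0 < \<gamma>" and \<beta>: "1 \<le> \<beta>"
    and int: "((\<lambda>s. kfrac \<gamma> (c - s) * kfrac \<beta> s) has_integral I) {a..b}"
  shows "I \<le> (kfrac (1 + \<gamma>) (c - a) - kfrac (1 + \<gamma>) (c - b)) * kfrac \<beta> b"
  using int has_integral_mult_left[OF has_integral_kfrac_reflected[OF \<gamma> ab(2,3)]]
proof (rule has_integral_le)
  fix s assume "s \<in> {a..b}"
  then show "kfrac \<gamma> (c - s) * kfrac \<beta> s \<le> kfrac \<gamma> (c - s) * kfrac \<beta> b"
    using ab by (intro mult_left_mono kfrac_mono \<beta> kfrac_nonneg \<gamma>) auto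
qed

lemma kfrac_increment_ge:
  assumes "1 \<le> \<beta>" "0 \<le> a" "a < b"
  shows "(b - a) * kfrac \<beta> a \<le> kfrac (1 + \<beta>) b - kfrac (1 + \<beta>) a"
proof (rule has_integral_le)
  show "((\<lambda>s. kfrac \<beta> a) has_integral (b - a) * kfrac \<beta> a) {a..b}"
    using has_integral_const_real[of "kfrac \<beta> a" a b] assms by simp
  show "(kfrac \<beta> has_integral kfrac (1 + \<beta>) b - kfrac (1 + \<beta>) a) {a..b}"
    using assms by (intro has_integral_kfrac) auto
qed (use assms in \<open>auto intro: kfrac_mono\<close>)

lemma kfrac_0: "kfrac \<beta> 0 = 0"
  by (simp add: kfrac_def)

lemma kfrac_1: "0 < x \<Longrightarrow> kfrac 1 x = 1"
  by (simp add: kfrac_def)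

section \<open>L1 kernels and their complementary kernels\<close>

locale L1_mesh =
  fixes \<alpha> :: real and t :: "nat \<Rightarrow> real" and N :: nat
  assumes alpha: "0 < \<alpha>" "\<alpha> < 1"
    and t_0: "t 0 = 0"
    and t_step: "\<And>n. 1 \<le> n \<Longrightarrow> n \<le> N \<Longrightarrow> t (n - 1) < t n"
begin

abbreviation K :: "nat \<Rightarrow> nat \<Rightarrow> real" where "K \<equiv> Kker \<alpha> t"
abbreviation P :: "nat \<Rightarrow> nat \<Rightarrow> real" where "P \<equiv> Pker \<alpha> t"

lemma t_strict_mono: "i < j \<Longrightarrow> j \<le> N \<Longrightarrow> t i < t j"
proof (induction j)
  case (Suc j)
  then show ?case
    using t_step[of "Suc j"] by (cases "i = j") auto
qed simp

lemma t_mono: "i \<le> j \<Longrightarrow> j \<le> N \<Longrightarrow> t i \<le> t j"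
  using t_strict_mono[of i j] by (cases "i = j") auto

lemma t_nonneg: "n \<le> N \<Longrightarrow> 0 \<le> t n"
  using t_mono[of 0 n] t_0 by simp

lemma t_pos: "1 \<le> n \<Longrightarrow> n \<le> N \<Longrightarrow> 0 < t n"
  using t_strict_mono[of 0 n] t_0 by simp

lemma tstep_pos: "1 \<le> n \<Longrightarrow> n \<le> N \<Longrightarrow> 0 < tstep t n"
  using t_step[of n] by (simp add: tstep_def)

lemma K_eq:
  assumes "1 \<le> j" "j \<le> n" "n \<le> N"
  shows "K n j = (kfrac (1 + (1 - \<alpha>)) (t n - t (j - 1)) - kfrac (1 + (1 - \<alpha>)) (t n - t j)) / (t j - t (j - 1))"
proof -
  have "t (j - 1) < t j" "t j \<le> t n"
    using assms t_step[of j] t_mono[of j n] by auto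
  then have "((\<lambda>s. kfrac (1 - \<alpha>) (t n - s)) has_integral
      kfrac (1 + (1 - \<alpha>)) (t n - t (j - 1)) - kfrac (1 + (1 - \<alpha>)) (t n - t j)) {t (j - 1)..t j}"
    using alpha by (intro has_integral_kfrac_reflected) auto
  from integral_unique[OF this] show ?thesis
    unfolding Kker_def tstep_def by simp
qed

lemma K_mvt:
  assumes "1 \<le> j" "j \<le> n" "n \<le> N"
  obtains s where "t (j - 1) < s" "s < t j" "K n j = kfrac (1 - \<alpha>) (t n - s)"
proof -
  have tj: "t (j - 1) < t j" "t j \<le> t n"
    using assms t_step[of j] t_mono[of j n] by auto
  then obtain s where "s \<in> {t (j - 1)<..<t j}"
      "kfrac (1 + (1 - \<alpha>)) (t n - t (j - 1)) - kfrac (1 + (1 - \<alpha>)) (t n - t j)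
        = (t j - t (j - 1)) * kfrac (1 - \<alpha>) (t n - s)"
    using kfrac_reflected_mvt[OF _ tj, of "1 - \<alpha>"] alpha by auto
  with tj show ?thesis
    by (intro that[of s]) (simp_all add: K_eq[OF assms])
qed

lemma K_pos:
  assumes "1 \<le> j" "j \<le> n" "n \<le> N"
  shows "0 < K n j"
proof -
  obtain s where "s < t j" "K n j = kfrac (1 - \<alpha>) (t n - s)"
    using K_mvt[OF assms] by metis
  then show ?thesis
    using t_mono[of j n] assms alpha by (auto intro!: kfrac_pos)
qed

text \<open>
  By \<open>K_mvt\<close> each kernel is a value of the strictly increasing function \<open>kfrac (1 - \<alpha>) (t n - s)\<close> of
  \<open>s\<close> inside its own mesh interval.
\<close>
lemma K_strict_mono:
  assumes "1 \<le> i" "i < n" "n \<le> N"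
  shows "K n i < K n (i + 1)"
proof -
  obtain r where r: "t (i - 1) < r" "r < t i" "K n i = kfrac (1 - \<alpha>) (t n - r)"
    using K_mvt[of i n] assms by auto
  obtain s where s: "t i < s" "s < t (i + 1)" "K n (i + 1) = kfrac (1 - \<alpha>) (t n - s)"
    using K_mvt[of "i + 1" n] assms by auto
  show ?thesis
    unfolding r s using r s alpha assms t_mono[of "i + 1" n] by (intro kfrac_strict_antimono) auto
qed

lemma K_mono: "1 \<le> i \<Longrightarrow> i < n \<Longrightarrow> n \<le> N \<Longrightarrow> K n i \<le> K n (i + 1)"
  by (rule less_imp_le[OF K_strict_mono])

lemma K_diag:
  assumes "1 \<le> n" "n \<le> N"
  shows "K n n = tstep t n powr (- \<alpha>) / Gamma (2 - \<alpha>)"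
proof -
  have "tstep t n powr (1 - \<alpha>) / tstep t n = tstep t n powr (- \<alpha>)"
    using tstep_pos[OF assms] powr_diff[of "tstep t n" "1 - \<alpha>" 1] by simp
  moreover have "K n n = tstep t n powr (1 - \<alpha>) / tstep t n / Gamma (2 - \<alpha>)"
    using K_eq[of n n] assms by (simp add: kfrac_0 kfrac_def tstep_def mult.commute)
  ultimately show ?thesis
    by simp
qed

lemma P_diag: "P n n = 1 / K n n"
  by (subst Pker.simps) simp

lemma P_rec: "i < n \<Longrightarrow> P n i = (\<Sum>j=i+1..n. P n j * (K j (i + 1) - K j i)) / K i i"
  by (subst Pker.simps) simp

lemma P_nonneg: "1 \<le> i \<Longrightarrow> i \<le> n \<Longrightarrow> n \<le> N \<Longrightarrow> 0 \<le> P n i"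
proof (induction "n - i" arbitrary: i rule: less_induct)
  case less
  show ?case
  proof (cases "i = n")
    case True
    then show ?thesis using less.prems K_pos[of n n] by (simp add: P_diag)
  next
    case False
    then have "i < n" using less.prems by simp
    then show ?thesis
      unfolding P_rec[OF \<open>i < n\<close>] using less.prems
      by (intro divide_nonneg_nonneg sum_nonneg mult_nonneg_nonneg less.hyps less_imp_le[OF K_pos])
         (auto simp: K_mono[simplified])
  qed
qed

text \<open>
  The recursion for \<open>P\<close> is exactly the statement that this sum does not change when \<open>m\<close> decreases by
  one.
\<close>
lemma sum_P_K:
  assumes "1 \<le> m" "m \<le> n" "n \<le> N"
  shows "(\<Sum>j=m..n. P n j * K j m) = 1"
  using assms(2,1)
proof (induction rule: inc_induct)
  case base
  then show ?case using K_pos[of n n] assms by (simp add: P_diag)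
next
  case (step m)
  have "(\<Sum>j=m..n. P n j * K j m) = P n m * K m m + (\<Sum>j=m+1..n. P n j * K j m)"
    using step by (simp add: sum.atLeast_Suc_atMost)
  also have "P n m * K m m = (\<Sum>j=m+1..n. P n j * (K j (m + 1) - K j m))"
    using P_rec[of m n] step K_pos[of m m] assms by simp
  also have "\<dots> + (\<Sum>j=m+1..n. P n j * K j m) = (\<Sum>j=m+1..n. P n j * K j (m + 1))"
    by (simp add: sum.distrib[symmetric] algebra_simps)
  also have "\<dots> = 1" using step by simp
  finally show ?case .
qed

section \<open>Discrete fractional integrals of powers\<close>

lemma integral_mesh_split:
  fixes f :: "real \<Rightarrow> real"
  assumes "n \<le> N" "f integrable_on {0..t n}"
  shows "(\<Sum>k=1..n. integral {t (k - 1)..t k} f) = integral {0..t n} f"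
  using assms
proof (induction n)
  case (Suc n)
  have tn: "0 \<le> t n" "t n \<le> t (Suc n)" using t_nonneg[of n] t_step[of "Suc n"] Suc.prems by auto
  then have "(\<Sum>k=1..n. integral {t (k - 1)..t k} f) = integral {0..t n} f"
    using Suc by (intro Suc.IH) (auto intro: integrable_on_subinterval)
  then show ?case
    using Henstock_Kurzweil_Integration.integral_combine[OF tn Suc.prems(2)] by simp
qed (simp add: t_0)

text \<open>
  The common first step of the comparisons for small and large \<open>\<beta>\<close>: the convolution that represents
  the power is split along the mesh, so that it can be bounded on each interval separately.
\<close>
lemma convolution_le:
  assumes \<beta>: "0 < \<beta>" and n: "1 \<le> n" "n \<le> N"
    and le: "\<And>k I. 1 \<le> k \<Longrightarrow> k \<le> n
      \<Longrightarrow> ((\<lambda>s. kfrac (1 - \<alpha>) (t n - s) * kfrac \<beta> s) has_integral I) {t (k - 1)..t k} \<Longrightarrow> I \<le> B k"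
  shows "kfrac (1 + \<beta> - \<alpha>) (t n) \<le> (\<Sum>k=1..n. B k)"
proof -
  let ?f = "\<lambda>s. kfrac (1 - \<alpha>) (t n - s) * kfrac \<beta> s"
  have f: "(?f has_integral kfrac (1 - \<alpha> + \<beta>) (t n)) {0..t n}"
    using alpha \<beta> t_pos[OF n] by (intro has_integral_kfrac_convolution) auto
  then have "kfrac (1 + \<beta> - \<alpha>) (t n) = (\<Sum>k=1..n. integral {t (k - 1)..t k} ?f)"
    using integral_mesh_split[of n ?f] n integral_unique[OF f] has_integral_integrable[OF f]
    by (simp add: add_diff_eq add.commute)
  also have "\<dots> \<le> (\<Sum>k=1..n. B k)"
  proof (intro sum_mono le)
    fix k assume k: "k \<in> {1..n}"
    show "(?f has_integral integral {t (k - 1)..t k} ?f) {t (k - 1)..t k}"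
    proof (intro integrable_integral integrable_on_subinterval[OF has_integral_integrable[OF f]])
      have "0 \<le> t (k - 1)" "t k \<le> t n"
        using k n by (auto intro: t_nonneg t_mono)
      then show "{t (k - 1)..t k} \<subseteq> {0..t n}" by auto
    qed
  qed auto
  finally show ?thesis .
qed

lemma sum_P_swap:
  "(\<Sum>j=1..m. P n j * (\<Sum>k=1..j. K j k * d k)) = (\<Sum>k=1..m. (\<Sum>j=k..m. P n j * K j k) * d k)"
proof -
  have "(\<Sum>j=1..m. P n j * (\<Sum>k=1..j. K j k * d k)) = (\<Sum>j=1..m. \<Sum>k=1..j. P n j * K j k * d k)"
    by (simp add: sum_distrib_left mult.assoc)
  also have "\<dots> = (\<Sum>j=1..m. \<Sum>k | k \<in> {1..m} \<and> k \<le> j. P n j * K j k * d k)"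
    by (intro sum.cong) auto
  also have "\<dots> = (\<Sum>k=1..m. \<Sum>j | j \<in> {1..m} \<and> k \<le> j. P n j * K j k * d k)"
    by (rule sum.swap_restrict) auto
  also have "\<dots> = (\<Sum>k=1..m. \<Sum>j=k..m. P n j * K j k * d k)"
    by (intro sum.cong) auto
  finally show ?thesis by (simp add: sum_distrib_right)
qed

text \<open>
  Summation against \<open>P\<close> is a left inverse of the L1 operator, up to the initial value: exchanging the sums
  gives every increment of \<open>\<phi>\<close> the weight 1 of \<open>sum_P_K\<close>.
\<close>
lemma sum_P_L1_deriv:
  assumes "n \<le> N"
  shows "(\<Sum>j=1..n. P n j * L1_deriv \<alpha> t \<phi> j) = \<phi> n - \<phi> 0"
proof -
  have "(\<Sum>j=1..n. P n j * L1_deriv \<alpha> t \<phi> j) = (\<Sum>k=1..n. (\<Sum>j=k..n. P n j * K j k) * (\<phi> k - \<phi> (k - 1)))"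
    unfolding L1_deriv_def by (rule sum_P_swap)
  also have "\<dots> = (\<Sum>k=1..n. \<phi> k - \<phi> (k - 1))"
    using assms by (intro sum.cong) (auto simp: sum_P_K)
  also have "\<dots> = \<phi> n - \<phi> 0"
    using sum_telescope''[of 0 n \<phi>] by simp
  finally show ?thesis .
qed

text \<open>
  For \<open>\<beta> \<le> 1\<close>, Chebyshev's inequality on each interval shows that the Caputo derivative of
  \<open>kfrac (1 + \<beta>)\<close>, which is \<open>kfrac (1 + \<beta> - \<alpha>)\<close>, is at most its L1 approximation.
\<close>
lemma sum_P_kfrac_concave:
  assumes \<beta>: "0 < \<beta>" "\<beta> \<le> 1" and n: "n \<le> N"
  shows "(\<Sum>j=1..n. P n j * kfrac (1 + \<beta> - \<alpha>) (t j)) \<le> kfrac (1 + \<beta>) (t n)"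
proof -
  have "(\<Sum>j=1..n. P n j * kfrac (1 + \<beta> - \<alpha>) (t j))
      \<le> (\<Sum>j=1..n. P n j * L1_deriv \<alpha> t (\<lambda>k. kfrac (1 + \<beta>) (t k)) j)"
  proof (intro sum_mono mult_left_mono P_nonneg)
    fix j assume j: "j \<in> {1..n}"
    show "kfrac (1 + \<beta> - \<alpha>) (t j) \<le> L1_deriv \<alpha> t (\<lambda>k. kfrac (1 + \<beta>) (t k)) j"
      unfolding L1_deriv_def
    proof (intro convolution_le)
      fix k I assume k: "1 \<le> k" "k \<le> j"
        and "((\<lambda>s. kfrac (1 - \<alpha>) (t j - s) * kfrac \<beta> s) has_integral I) {t (k - 1)..t k}"
      then show "I \<le> K j k * (kfrac (1 + \<beta>) (t k) - kfrac (1 + \<beta>) (t (k - 1)))"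
        using chebyshev_kfrac[of "t (k - 1)" "t k" "t j" "1 - \<alpha>" \<beta> I] alpha \<beta> j n k
          t_nonneg[of "k - 1"] t_step[of k] t_mono[of k j] by (simp add: K_eq)
    qed (use j n \<beta> in auto)
  qed (use n in auto)
  also have "\<dots> = kfrac (1 + \<beta>) (t n)"
    by (subst sum_P_L1_deriv[OF n]) (simp add: t_0 kfrac_0)
  finally show ?thesis .
qed

text \<open>
  For \<open>\<beta> \<ge> 1\<close> the kernel \<open>kfrac \<beta>\<close> is nondecreasing, so its values on the \<open>k\<close>-th interval are at most
  its mean over the next one. As that interval is not shorter, the increment of \<open>kfrac (1 + \<beta>)\<close>
  over the interval \<open>k + 1\<close> may replace that over the interval \<open>k\<close>, as long as \<open>k + 1 \<le> n\<close>; this is why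
  the sum stops at \<open>n - 1\<close>.
\<close>
lemma sum_P_kfrac_convex:
  assumes \<beta>: "1 \<le> \<beta>" and n: "1 \<le> n" "n \<le> N"
    and graded: "\<And>k. 2 \<le> k \<Longrightarrow> k \<le> N \<Longrightarrow> tstep t (k - 1) \<le> tstep t k"
  shows "(\<Sum>j=1..n-1. P n j * kfrac (1 + \<beta> - \<alpha>) (t j)) \<le> kfrac (1 + \<beta>) (t n)"
proof -
  let ?d = "\<lambda>k. kfrac (1 + \<beta>) (t (k + 1)) - kfrac (1 + \<beta>) (t k)"
  have d: "0 \<le> ?d k" if "k < N" for k
  proof -
    have "0 \<le> t k" "t k \<le> t (k + 1)"
      using that by (auto intro: t_nonneg t_mono)
    then show ?thesis
      using kfrac_mono[of "1 + \<beta>" "t k" "t (k + 1)"] \<beta> by simp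
  qed
  have "(\<Sum>j=1..n-1. P n j * kfrac (1 + \<beta> - \<alpha>) (t j))
      \<le> (\<Sum>j=1..n-1. P n j * (\<Sum>k=1..j. K j k * ?d k))"
  proof (intro sum_mono mult_left_mono P_nonneg)
    fix j assume j: "j \<in> {1..n-1}"
    show "kfrac (1 + \<beta> - \<alpha>) (t j) \<le> (\<Sum>k=1..j. K j k * ?d k)"
    proof (intro convolution_le)
      fix k I assume k: "1 \<le> k" "k \<le> j"
        and I: "((\<lambda>s. kfrac (1 - \<alpha>) (t j - s) * kfrac \<beta> s) has_integral I) {t (k - 1)..t k}"
      have tk: "0 \<le> t (k - 1)" "t (k - 1) < t k" "t k \<le> t j" "0 \<le> t k" "t k < t (k + 1)"
        using j k n t_nonneg[of "k - 1"] t_step[of k] t_mono[of k j] t_step[of "k + 1"] t_nonneg[of k] by auto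
      have "I \<le> K j k * (tstep t k * kfrac \<beta> (t k))"
        using convolution_le_right_endpoint[OF tk(1-3) _ \<beta> I] K_eq[of k j] j k n tk alpha by (simp add: tstep_def)
      also have "\<dots> \<le> K j k * (tstep t (k + 1) * kfrac \<beta> (t k))"
        using graded[of "k + 1"] j k n \<beta>
        by (intro mult_left_mono mult_right_mono kfrac_nonneg less_imp_le[OF K_pos]) auto
      also have "\<dots> \<le> K j k * ?d k"
        using kfrac_increment_ge[OF \<beta> tk(4,5)] j k n
        by (intro mult_left_mono less_imp_le[OF K_pos]) (auto simp: tstep_def)
      finally show "I \<le> K j k * ?d k" .
    qed (use j n \<beta> in auto)
  qed (use n in auto)
  also have "\<dots> = (\<Sum>k=1..n-1. (\<Sum>j=k..n-1. P n j * K j k) * ?d k)"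
    by (rule sum_P_swap)
  also have "\<dots> \<le> (\<Sum>k=1..n-1. 1 * ?d k)"
  proof (intro sum_mono mult_right_mono d)
    fix k assume k: "k \<in> {1..n-1}"
    have kn: "1 \<le> k" "k \<le> n" using k by auto
    have "(\<Sum>j=k..n-1. P n j * K j k) \<le> (\<Sum>j=k..n. P n j * K j k)"
      using kn n by (intro sum_mono2 mult_nonneg_nonneg P_nonneg less_imp_le[OF K_pos]) auto
    then show "(\<Sum>j=k..n-1. P n j * K j k) \<le> 1"
      using sum_P_K[OF kn n(2)] by simp
  qed (use n in auto)
  also have "\<dots> = kfrac (1 + \<beta>) (t n) - kfrac (1 + \<beta>) (t 1)"
  proof -
    have "{1..n-1} = {1..<n}" using n by auto
    then show ?thesis
      using sum_Suc_diff'[of 1 n "\<lambda>k. kfrac (1 + \<beta>) (t k)"] n by simp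
  qed
  also have "\<dots> \<le> kfrac (1 + \<beta>) (t n)"
    using kfrac_nonneg[of "1 + \<beta>"] \<beta> by simp
  finally show ?thesis .
qed

end

section \<open>Mittag-Leffler functions under discrete fractional integration\<close>

definition mittag_leffler_partial :: "real \<Rightarrow> nat \<Rightarrow> real \<Rightarrow> real" where
  "mittag_leffler_partial a M z = (\<Sum>m<M. z ^ m / Gamma (real m * a + 1))"

lemma Gamma_mittag_leffler_pos: "0 < a \<Longrightarrow> 0 < Gamma (real m * a + 1)"
  by (intro Gamma_real_pos add_nonneg_pos) auto

lemma mittag_leffler_term_nonneg: "0 < a \<Longrightarrow> 0 \<le> z \<Longrightarrow> 0 \<le> z ^ m / Gamma (real m * a + 1)"
  using Gamma_mittag_leffler_pos[of a m] by simp

lemma mittag_leffler_term_mono: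
  "0 < a \<Longrightarrow> 0 \<le> w \<Longrightarrow> w \<le> z \<Longrightarrow> w ^ m / Gamma (real m * a + 1) \<le> z ^ m / Gamma (real m * a + 1)"
  using Gamma_mittag_leffler_pos[of a m] by (intro divide_right_mono power_mono) auto

lemma mittag_leffler_mono:
  "0 < a \<Longrightarrow> 0 \<le> w \<Longrightarrow> w \<le> z \<Longrightarrow> mittag_leffler a w \<le> mittag_leffler a z"
  unfolding mittag_leffler_def by (intro suminf_le summable_mittag_leffler mittag_leffler_term_mono)

lemma mittag_leffler_partial_mono:
  assumes "0 < a" "0 \<le> w" "w \<le> z" "L \<le> M"
  shows "mittag_leffler_partial a L w \<le> mittag_leffler_partial a M z"
proof -
  have "mittag_leffler_partial a L w \<le> mittag_leffler_partial a L z"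
    unfolding mittag_leffler_partial_def using assms by (intro sum_mono mittag_leffler_term_mono)
  also have "\<dots> \<le> mittag_leffler_partial a M z"
    unfolding mittag_leffler_partial_def
    using assms by (intro sum_mono2) (auto intro: mittag_leffler_term_nonneg)
  finally show ?thesis .
qed

lemma mittag_leffler_partial_le:
  assumes "0 < a" "0 \<le> z"
  shows "mittag_leffler_partial a M z \<le> mittag_leffler a z"
  unfolding mittag_leffler_partial_def mittag_leffler_def using assms
  by (intro sum_le_suminf summable_mittag_leffler) (auto intro: mittag_leffler_term_nonneg)

lemma mittag_leffler_partial_ge_1:
  assumes "0 < a" "0 \<le> z" "1 \<le> M"
  shows "1 \<le> mittag_leffler_partial a M z"
  using mittag_leffler_partial_mono[OF assms(1) order_refl assms(2,3)]
  by (simp add: mittag_leffler_partial_def)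

lemma mittag_leffler_ge_1: "0 < a \<Longrightarrow> 0 \<le> z \<Longrightarrow> 1 \<le> mittag_leffler a z"
  using mittag_leffler_partial_ge_1[of a z 1] mittag_leffler_partial_le[of a z 1] by simp

text \<open>
  The positivity of \<open>x\<close> matters for \<open>m = 0\<close>: the left hand side is 1 at \<open>x = 0\<close>, whereas \<open>kfrac 1 0 = 0\<close>.
\<close>
lemma mittag_leffler_term_kfrac:
  "0 < x \<Longrightarrow> (\<mu> * x powr a) ^ m / Gamma (real m * a + 1) = \<mu> ^ m * kfrac (1 + real m * a) x"
  by (simp add: kfrac_def power_mult_distrib powr_power mult.commute add.commute)

lemma max_over_ge: "finite A \<Longrightarrow> j \<in> A \<Longrightarrow> f j \<le> max_over A f"
  by (auto simp: max_over_def)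

lemma max_over_least: "finite A \<Longrightarrow> 0 \<le> b \<Longrightarrow> (\<And>j. j \<in> A \<Longrightarrow> f j \<le> b) \<Longrightarrow> max_over A f \<le> b"
  by (auto simp: max_over_def)

lemma max_over_nonneg:
  assumes "finite A" "\<And>j. j \<in> A \<Longrightarrow> 0 \<le> f j"
  shows "0 \<le> max_over A f"
proof (cases "A = {}")
  case False
  then obtain j where "j \<in> A" by auto
  then show ?thesis using max_over_ge[OF assms(1), of j f] assms(2)[of j] by linarith
qed (simp add: max_over_def)

lemma max_over_subset:
  assumes "finite B" "A \<subseteq> B" "\<And>j. j \<in> B \<Longrightarrow> 0 \<le> f j"
  shows "max_over A f \<le> max_over B f"
  using assms by (intro max_over_least max_over_nonneg max_over_ge) (auto intro: finite_subset)

context L1_mesh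
begin

text \<open>
  The case \<open>\<beta> = \<alpha>\<close> of \<open>sum_P_kfrac_concave\<close> has the constant \<open>1 / Gamma (1 + \<alpha>)\<close>; its bound 2 is
  the constant under the square root in the Gronwall inequality.
\<close>
lemma sum_P_le:
  assumes "n \<le> N"
  shows "(\<Sum>j=1..n. P n j) \<le> 2 * t n powr \<alpha>"
proof -
  have "(\<Sum>j=1..n. P n j) = (\<Sum>j=1..n. P n j * kfrac (1 + \<alpha> - \<alpha>) (t j))"
    using assms by (intro sum.cong) (auto simp: kfrac_1 t_pos)
  also have "\<dots> \<le> kfrac (1 + \<alpha>) (t n)"
    using alpha assms by (intro sum_P_kfrac_concave) auto
  also have "\<dots> \<le> t n powr \<alpha> / (1 / 2)"
    unfolding kfrac_def using Gamma_1_plus_ge_half[of \<alpha>] alpha by (intro frac_le) auto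
  finally show ?thesis by simp
qed

text \<open>
  A bound for the discrete fractional integral of a power raises the degree of a Mittag-Leffler term by one.
  The index set \<open>J\<close> is left open, since small powers allow the whole range \<open>{1..n}\<close> and large
  powers only \<open>{1..n-1}\<close>.
\<close>
lemma sum_P_mittag_leffler_term:
  assumes J: "J \<subseteq> {1..n}" and n: "1 \<le> n" "n \<le> N"
    and le: "(\<Sum>j\<in>J. P n j * kfrac (1 + real (Suc m) * \<alpha> - \<alpha>) (t j)) \<le> kfrac (1 + real (Suc m) * \<alpha>) (t n)"
    and \<mu>: "0 \<le> \<mu>"
  shows "\<mu> * (\<Sum>j\<in>J. P n j * ((\<mu> * t j powr \<alpha>) ^ m / Gamma (real m * \<alpha> + 1)))
    \<le> (\<mu> * t n powr \<alpha>) ^ Suc m / Gamma (real (Suc m) * \<alpha> + 1)"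
proof -
  have "\<mu> * (\<Sum>j\<in>J. P n j * ((\<mu> * t j powr \<alpha>) ^ m / Gamma (real m * \<alpha> + 1)))
      = \<mu> * (\<Sum>j\<in>J. P n j * (\<mu> ^ m * kfrac (1 + real (Suc m) * \<alpha> - \<alpha>) (t j)))"
  proof (intro arg_cong[where f = "(*) \<mu>"] sum.cong refl arg_cong2[where f = "(*)"])
    fix j assume "j \<in> J"
    then have "0 < t j" using J n by (auto intro!: t_pos)
    moreover have "1 + real (Suc m) * \<alpha> - \<alpha> = 1 + real m * \<alpha>" by (simp add: algebra_simps)
    ultimately show "(\<mu> * t j powr \<alpha>) ^ m / Gamma (real m * \<alpha> + 1) = \<mu> ^ m * kfrac (1 + real (Suc m) * \<alpha> - \<alpha>) (t j)"
      by (simp only: mittag_leffler_term_kfrac)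
  qed
  also have "\<dots> = \<mu> ^ Suc m * (\<Sum>j\<in>J. P n j * kfrac (1 + real (Suc m) * \<alpha> - \<alpha>) (t j))"
    by (simp only: sum_distrib_left power_Suc mult_ac)
  also have "\<dots> \<le> \<mu> ^ Suc m * kfrac (1 + real (Suc m) * \<alpha>) (t n)"
    using \<mu> by (intro mult_left_mono le) auto
  also have "\<dots> = (\<mu> * t n powr \<alpha>) ^ Suc m / Gamma (real (Suc m) * \<alpha> + 1)"
    using t_pos[OF n] by (simp only: mittag_leffler_term_kfrac)
  finally show ?thesis .
qed

text \<open>
  All exponents that occur are at most \<open>M * \<alpha> \<le> 1\<close>, so the concave case covers every term and
  the sum may include \<open>j = n\<close>. The degree of the partial sum rises from \<open>M - 1\<close> to \<open>M\<close>.
\<close>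
lemma sum_P_mittag_leffler_partial:
  assumes n: "1 \<le> n" "n \<le> N" and M: "real M * \<alpha> \<le> 1" and \<mu>: "0 \<le> \<mu>"
  shows "1 + \<mu> * (\<Sum>j=1..n. P n j * mittag_leffler_partial \<alpha> M (\<mu> * t j powr \<alpha>))
    \<le> mittag_leffler_partial \<alpha> (Suc M) (\<mu> * t n powr \<alpha>)"
proof -
  have "\<mu> * (\<Sum>j=1..n. P n j * mittag_leffler_partial \<alpha> M (\<mu> * t j powr \<alpha>))
     = (\<Sum>m<M. \<mu> * (\<Sum>j=1..n. P n j * ((\<mu> * t j powr \<alpha>) ^ m / Gamma (real m * \<alpha> + 1))))"
    unfolding mittag_leffler_partial_def sum_distrib_left by (rule sum.swap)
  also have "\<dots> \<le> (\<Sum>m<M. (\<mu> * t n powr \<alpha>) ^ Suc m / Gamma (real (Suc m) * \<alpha> + 1))"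
  proof (intro sum_mono sum_P_mittag_leffler_term sum_P_kfrac_concave)
    fix m assume "m \<in> {..<M}"
    then have "real (Suc m) * \<alpha> \<le> real M * \<alpha>"
      using alpha by (intro mult_right_mono) auto
    then show "real (Suc m) * \<alpha> \<le> 1" using M by simp
  qed (use n \<mu> alpha in auto)
  finally show ?thesis
    unfolding mittag_leffler_partial_def by (subst sum.lessThan_Suc_shift) simp
qed

text \<open>
  Termwise summation of the power series; the index \<open>j = n\<close> is omitted because of the terms of degree
  above \<open>1 / \<alpha>\<close>.
\<close>
lemma sum_P_mittag_leffler:
  assumes n: "1 \<le> n" "n \<le> N" and \<mu>: "0 \<le> \<mu>"
    and graded: "\<And>k. 2 \<le> k \<Longrightarrow> k \<le> N \<Longrightarrow> tstep t (k - 1) \<le> tstep t k"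
  shows "1 + \<mu> * (\<Sum>j=1..n-1. P n j * mittag_leffler \<alpha> (\<mu> * t j powr \<alpha>))
    \<le> mittag_leffler \<alpha> (\<mu> * t n powr \<alpha>)"
proof -
  let ?e = "\<lambda>m j. (\<mu> * t j powr \<alpha>) ^ m / Gamma (real m * \<alpha> + 1)"
  have S: "summable (\<lambda>m. ?e m j)" for j
    using alpha by (intro summable_mittag_leffler)
  have S': "summable (\<lambda>m. P n j * ?e m j)" for j
    by (rule summable_mult[OF S])
  have "\<mu> * (\<Sum>j=1..n-1. P n j * mittag_leffler \<alpha> (\<mu> * t j powr \<alpha>))
     = \<mu> * (\<Sum>j=1..n-1. \<Sum>m. P n j * ?e m j)"
    unfolding mittag_leffler_def by (simp only: suminf_mult[OF S])
  also have "\<dots> = \<mu> * (\<Sum>m. \<Sum>j=1..n-1. P n j * ?e m j)"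
    by (subst suminf_sum[OF S']) (rule refl)
  also have "\<dots> = (\<Sum>m. \<mu> * (\<Sum>j=1..n-1. P n j * ?e m j))"
    by (rule suminf_mult[OF summable_sum[OF S'], symmetric])
  also have "\<dots> \<le> (\<Sum>m. ?e (Suc m) n)"
  proof (rule suminf_le)
    fix m
    have "(\<Sum>j=1..n-1. P n j * kfrac (1 + real (Suc m) * \<alpha> - \<alpha>) (t j)) \<le> kfrac (1 + real (Suc m) * \<alpha>) (t n)"
    proof (cases "1 \<le> real (Suc m) * \<alpha>")
      case True
      then show ?thesis by (intro sum_P_kfrac_convex n graded)
    next
      case False
      have "(\<Sum>j=1..n-1. P n j * kfrac (1 + real (Suc m) * \<alpha> - \<alpha>) (t j))
          \<le> (\<Sum>j=1..n. P n j * kfrac (1 + real (Suc m) * \<alpha> - \<alpha>) (t j))"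
      proof (intro sum_mono2 mult_nonneg_nonneg P_nonneg kfrac_nonneg)
        show "0 < 1 + real (Suc m) * \<alpha> - \<alpha>"
          using alpha by (simp add: algebra_simps add_pos_nonneg)
      qed (use n in auto)
      also have "\<dots> \<le> kfrac (1 + real (Suc m) * \<alpha>) (t n)"
        using False alpha n by (intro sum_P_kfrac_concave) auto
      finally show ?thesis .
    qed
    then show "\<mu> * (\<Sum>j=1..n-1. P n j * ?e m j) \<le> ?e (Suc m) n"
      using n \<mu> by (intro sum_P_mittag_leffler_term) auto
  next
    show "summable (\<lambda>m. \<mu> * (\<Sum>j=1..n-1. P n j * ?e m j))"
      by (intro summable_mult summable_sum S)
    show "summable (\<lambda>m. ?e (Suc m) n)"
      using S[of n] by (subst summable_Suc_iff)
  qed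
  also have "(\<Sum>m. ?e (Suc m) n) = mittag_leffler \<alpha> (\<mu> * t n powr \<alpha>) - 1"
    unfolding mittag_leffler_def using suminf_split_head[OF S[of n]] by simp
  finally show ?thesis by simp
qed

text \<open>
  The recursion gives \<open>P j j / P j (j - 1) = K (j - 1) (j - 1) / (K j j - K j (j - 1))\<close>. The diagonal
  kernels are explicit powers of the step sizes. The average \<open>K j (j - 1)\<close> is at most the value of the
  integrand at the right end point of its interval, \<open>kfrac (1 - \<alpha>) (tstep t j) = (1 - \<alpha>) * K j j\<close>,
  so the denominator is at least \<open>\<alpha> * K j j\<close>.
\<close>
lemma
  assumes j: "2 \<le> j" "j \<le> N"
  shows P_subdiag_pos: "0 < P j (j - 1)"
    and P_ratio_nonneg: "0 \<le> P j j / P j (j - 1)"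
    and P_ratio_le: "P j j / P j (j - 1) \<le> mu t j powr \<alpha> / \<alpha>"
proof -
  obtain i where i: "j = Suc i" "1 \<le> i" using j by (cases j) auto
  have K: "0 < K j j" "0 < K i i" "K j i < K j j"
    using K_pos[of j j] K_pos[of i i] K_strict_mono[of i j] i j by auto
  have P: "P j i = (K j j - K j i) / (K j j * K i i)"
    using P_rec[of i j] i by (simp add: P_diag)
  then show "0 < P j (j - 1)" using K i by simp
  then show "0 \<le> P j j / P j (j - 1)" using K by (simp add: P_diag)
  have "K j i \<le> (1 - \<alpha>) * K j j"
  proof -
    obtain s where s: "t (i - 1) < s" "s < t i" "K j i = kfrac (1 - \<alpha>) (t j - s)"
      using K_mvt[of i j] i j by auto
    have "kfrac (1 - \<alpha>) (t j - s) \<le> kfrac (1 - \<alpha>) (tstep t j)"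
      using s tstep_pos[of j] j alpha i by (intro kfrac_antimono) (auto simp: tstep_def)
    also have "\<dots> = tstep t j powr (- \<alpha>) / Gamma (1 - \<alpha>)"
      by (simp add: kfrac_def)
    also have "\<dots> = (1 - \<alpha>) * K j j"
      using K_diag[of j] j alpha Gamma_1_plus[of "1 - \<alpha>"] by simp
    finally show ?thesis using s by simp
  qed
  then have "\<alpha> * K j j \<le> K j j - K j i" by (simp add: algebra_simps)
  moreover have "P j j / P j i = K i i / (K j j - K j i)"
    using K by (simp add: P P_diag)
  ultimately have "P j j / P j i \<le> K i i / (\<alpha> * K j j)"
    using K alpha by (auto intro!: frac_le)
  moreover have G: "Gamma (2 - \<alpha>) \<noteq> 0"
    using alpha by (intro less_imp_neq[OF Gamma_real_pos, symmetric]) simp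
  ultimately have "P j j / P j i \<le> K i i / (\<alpha> * K j j)" by simp
  also have "K i i / (\<alpha> * K j j) = (tstep t i powr (- \<alpha>) / tstep t j powr (- \<alpha>)) / \<alpha>"
    using K_diag[of i] K_diag[of j] i j G by simp
  also have "tstep t i powr (- \<alpha>) / tstep t j powr (- \<alpha>) = mu t j powr \<alpha>"
    using tstep_pos[of i] tstep_pos[of j] i j by (simp add: mu_def powr_divide powr_minus field_simps)
  finally show "P j j / P j (j - 1) \<le> mu t j powr \<alpha> / \<alpha>" using i by simp
qed

end

section \<open>The discrete fractional Gronwall inequality\<close>

locale L1_gronwall = L1_mesh \<alpha> t N
  for \<alpha> :: real and t :: "nat \<Rightarrow> real" and N :: nat +
  fixes v \<xi> \<eta> \<zeta> :: "nat \<Rightarrow> real" and lam :: "nat \<Rightarrow> nat \<Rightarrow> real" and \<Lambda> \<delta> :: real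
  assumes v_nonneg: "\<And>n. n \<le> N \<Longrightarrow> 0 \<le> v n"
    and source_nonneg: "\<And>n. 1 \<le> n \<Longrightarrow> n \<le> N \<Longrightarrow> 0 \<le> \<xi> n \<and> 0 \<le> \<eta> n \<and> 0 \<le> \<zeta> n"
    and lam_nonneg: "\<And>n j. 1 \<le> n \<Longrightarrow> n \<le> N \<Longrightarrow> j \<le> n \<Longrightarrow> 0 \<le> lam n j"
    and L1_deriv_le: "\<And>n. 1 \<le> n \<Longrightarrow> n \<le> N \<Longrightarrow> L1_deriv \<alpha> t (\<lambda>i. (v i)\<^sup>2) n
           \<le> (\<Sum>i=0..n. lam n (n - i) * (v i)\<^sup>2) + v n * \<xi> n + (\<eta> n)\<^sup>2 + (\<zeta> n)\<^sup>2"
    and Lambda_pos: "0 < \<Lambda>"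
    and lam_sum: "\<And>n. 1 \<le> n \<Longrightarrow> n \<le> N \<Longrightarrow> (\<Sum>j=0..n. lam n j) \<le> \<Lambda>"
    and graded: "\<And>n. 2 \<le> n \<Longrightarrow> n \<le> N \<Longrightarrow> tstep t (n - 1) \<le> tstep t n"
    and delta: "1 < \<delta>"
    and step_le: "max_over {1..N} (\<lambda>n. lam n 0) = 0 \<or>
         max_over {1..N} (tstep t)
           \<le> (\<delta> * Gamma (2 - \<alpha>) * max_over {1..N} (\<lambda>n. lam n 0)) powr (- 1 / \<alpha>)"
begin

lemma P_diag_lam_le:
  assumes n: "1 \<le> n" "n \<le> N"
  shows "P n n * lam n 0 \<le> 1 / \<delta>"
proof -
  let ?M = "max_over {1..N} (\<lambda>n. lam n 0)"
  have lam: "0 \<le> lam n 0" "lam n 0 \<le> ?M"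
    using n max_over_ge[of "{1..N}" n "\<lambda>n. lam n 0"] lam_nonneg[of n 0] by auto
  show ?thesis
  proof (cases "lam n 0 = 0")
    case True
    then show ?thesis using delta by simp
  next
    case False
    have G: "0 < Gamma (2 - \<alpha>)" using alpha by (intro Gamma_real_pos) simp
    have M: "0 < ?M" using lam False by simp
    have D: "0 < tstep t n" "tstep t n \<le> max_over {1..N} (tstep t)"
      using n tstep_pos max_over_ge[of "{1..N}" n "tstep t"] by auto
    then have "tstep t n \<le> (\<delta> * Gamma (2 - \<alpha>) * ?M) powr (- 1 / \<alpha>)"
      using step_le M by linarith
    then have "tstep t n powr \<alpha> \<le> ((\<delta> * Gamma (2 - \<alpha>) * ?M) powr (- 1 / \<alpha>)) powr \<alpha>"
      using alpha D by (intro powr_mono2) auto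
    also have "\<dots> = 1 / (\<delta> * Gamma (2 - \<alpha>) * ?M)"
      unfolding powr_powr using alpha delta G M by (simp add: powr_minus_divide)
    finally have le: "tstep t n powr \<alpha> * (Gamma (2 - \<alpha>) * ?M) \<le> 1 / \<delta>"
      using delta G M by (simp add: field_simps)
    have "P n n * lam n 0 = tstep t n powr \<alpha> * (Gamma (2 - \<alpha>) * lam n 0)"
      using n by (simp add: P_diag K_diag powr_minus field_simps)
    also have "\<dots> \<le> tstep t n powr \<alpha> * (Gamma (2 - \<alpha>) * ?M)"
      using G lam by (intro mult_left_mono) auto
    finally show ?thesis using le by simp
  qed
qed

definition data :: "nat \<Rightarrow> real" where
  "data n = v 0 + max_over {1..n} (\<lambda>j. \<Sum>i=1..j. P j i * \<xi> i)
     + sqrt (2 * t n powr \<alpha>) * max_over {1..n} \<eta>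
     + max_over {1..n} (\<lambda>j. sqrt (\<Sum>i=1..j. P j i * (\<zeta> i)\<^sup>2))"

lemma data_summand_nonneg:
  assumes "n \<le> N"
  shows "0 \<le> max_over {1..n} (\<lambda>j. \<Sum>i=1..j. P j i * \<xi> i)"
    and "0 \<le> max_over {1..n} \<eta>"
    and "0 \<le> max_over {1..n} (\<lambda>j. sqrt (\<Sum>i=1..j. P j i * (\<zeta> i)\<^sup>2))"
  using assms source_nonneg
  by (auto intro!: max_over_nonneg sum_nonneg mult_nonneg_nonneg P_nonneg)

lemma data_mono:
  assumes "m \<le> n" "n \<le> N"
  shows "data m \<le> data n"
proof -
  have "max_over {1..m} (\<lambda>j. \<Sum>i=1..j. P j i * \<xi> i) \<le> max_over {1..n} (\<lambda>j. \<Sum>i=1..j. P j i * \<xi> i)"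
    using assms source_nonneg by (intro max_over_subset sum_nonneg mult_nonneg_nonneg P_nonneg) auto
  moreover have "max_over {1..m} (\<lambda>j. sqrt (\<Sum>i=1..j. P j i * (\<zeta> i)\<^sup>2))
      \<le> max_over {1..n} (\<lambda>j. sqrt (\<Sum>i=1..j. P j i * (\<zeta> i)\<^sup>2))"
    using assms by (intro max_over_subset real_sqrt_ge_zero sum_nonneg mult_nonneg_nonneg P_nonneg) auto
  moreover have "sqrt (2 * t m powr \<alpha>) * max_over {1..m} \<eta> \<le> sqrt (2 * t n powr \<alpha>) * max_over {1..n} \<eta>"
  proof (intro mult_mono max_over_subset real_sqrt_le_mono mult_left_mono powr_mono2)
    show "t m \<le> t n" "0 \<le> t m"
      using assms by (auto intro: t_mono t_nonneg)
    show "0 \<le> max_over {1..m} \<eta>"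
      using assms by (intro data_summand_nonneg) auto
  qed (use assms alpha source_nonneg in auto)
  ultimately show ?thesis
    unfolding data_def by linarith
qed

lemma v_0_le_data: "n \<le> N \<Longrightarrow> v 0 \<le> data n"
  using data_summand_nonneg[of n] by (simp add: data_def)

lemma data_nonneg: "n \<le> N \<Longrightarrow> 0 \<le> data n"
  using v_0_le_data[of n] v_nonneg[of 0] by simp

lemma C_delta_ge_1: "1 \<le> C_delta \<delta>"
  using delta by (simp add: C_delta_def)

lemma sum_lam_le:
  assumes j: "1 \<le> j" "j \<le> N" and w: "0 \<le> w" "\<And>i. i \<le> j \<Longrightarrow> u i \<le> w"
  shows "(\<Sum>i=0..j. lam j (j - i) * u i) \<le> \<Lambda> * w"
proof -
  have "(\<Sum>i=0..j. lam j (j - i) * u i) \<le> (\<Sum>i=0..j. lam j (j - i) * w)"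
    using j by (intro sum_mono mult_left_mono w lam_nonneg) auto
  also have "\<dots> = (\<Sum>i=0..j. lam j i) * w"
    using sum.atLeastAtMost_rev[of "lam j" 0 j] by (simp add: sum_distrib_right)
  also have "\<dots> \<le> \<Lambda> * w"
    using j by (intro mult_right_mono lam_sum w)
  finally show ?thesis .
qed

text \<open>
  After inversion of the L1 operator, each quadratic term on the right is at most \<open>v n\<close> times a linear
  one. For the values of \<open>v\<close> this is the maximality of \<open>v n\<close>; for \<open>\<eta>\<close> and \<open>\<zeta>\<close> it holds since \<open>v n\<close>
  dominates \<open>data n\<close>, hence each of its summands. Then \<open>v n\<close> cancels.
\<close>
lemma linearised_inequality:
  assumes n: "1 \<le> n" "n \<le> N" and max: "\<And>i. i < n \<Longrightarrow> v i \<le> v n" and big: "data n \<le> v n" "0 < v n"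
  shows "v n \<le> data n + (\<Sum>j=1..n. P n j * (\<Sum>i=0..j. lam j (j - i) * v i))"
proof -
  let ?V = "v n" and ?s = "\<lambda>j. \<Sum>i=0..j. lam j (j - i) * v i"
  let ?X = "max_over {1..n} (\<lambda>j. \<Sum>i=1..j. P j i * \<xi> i)"
  let ?Y = "max_over {1..n} \<eta>"
  let ?Z = "max_over {1..n} (\<lambda>j. sqrt (\<Sum>i=1..j. P j i * (\<zeta> i)\<^sup>2))"
  let ?q = "sqrt (2 * t n powr \<alpha>)"
  have max': "v i \<le> ?V" if "i \<le> n" for i using max[of i] that by (cases "i = n") auto
  have Pn: "0 \<le> P n j" if "j \<in> {1..n}" for j using P_nonneg[of j n] that n by auto
  note nn = data_summand_nonneg[OF n(2)] v_nonneg[of 0]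
  have Y0: "0 \<le> ?q * ?Y" using nn by simp
  have Y: "?q * ?Y \<le> ?V" and Z: "?Z \<le> ?V"
    using big nn Y0 unfolding data_def by linarith+
  have "?V\<^sup>2 - (v 0)\<^sup>2 = (\<Sum>j=1..n. P n j * L1_deriv \<alpha> t (\<lambda>i. (v i)\<^sup>2) j)"
    by (rule sum_P_L1_deriv[OF n(2), symmetric])
  also have "\<dots> \<le> (\<Sum>j=1..n. P n j * (?V * ?s j + ?V * \<xi> j + ?Y\<^sup>2 + (\<zeta> j)\<^sup>2))"
  proof (intro sum_mono mult_left_mono Pn)
    fix j assume j: "j \<in> {1..n}"
    then have jN: "1 \<le> j" "j \<le> N" using n by auto
    have "(\<Sum>i=0..j. lam j (j - i) * (v i)\<^sup>2) \<le> (\<Sum>i=0..j. ?V * (lam j (j - i) * v i))"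
    proof (intro sum_mono)
      fix i assume i: "i \<in> {0..j}"
      then have "lam j (j - i) * v i * v i \<le> lam j (j - i) * v i * ?V"
        using j jN by (intro mult_left_mono mult_nonneg_nonneg lam_nonneg v_nonneg max') auto
      then show "lam j (j - i) * (v i)\<^sup>2 \<le> ?V * (lam j (j - i) * v i)"
        by (simp add: power2_eq_square mult_ac)
    qed
    then have "(\<Sum>i=0..j. lam j (j - i) * (v i)\<^sup>2) \<le> ?V * ?s j"
      by (simp add: sum_distrib_left)
    moreover have "v j * \<xi> j \<le> ?V * \<xi> j"
      using j source_nonneg[OF jN] by (intro mult_right_mono max') auto
    moreover have "(\<eta> j)\<^sup>2 \<le> ?Y\<^sup>2"
      using j source_nonneg[OF jN] by (intro power_mono max_over_ge) auto
    ultimately show "L1_deriv \<alpha> t (\<lambda>i. (v i)\<^sup>2) j \<le> ?V * ?s j + ?V * \<xi> j + ?Y\<^sup>2 + (\<zeta> j)\<^sup>2"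
      using L1_deriv_le[OF jN] by linarith
  qed
  also have "\<dots> = ?V * (\<Sum>j=1..n. P n j * ?s j) + ?V * (\<Sum>j=1..n. P n j * \<xi> j)
      + (\<Sum>j=1..n. P n j) * ?Y\<^sup>2 + (\<Sum>j=1..n. P n j * (\<zeta> j)\<^sup>2)"
    by (simp add: distrib_left sum.distrib sum_distrib_left sum_distrib_right mult_ac)
  also have "\<dots> \<le> ?V * (\<Sum>j=1..n. P n j * ?s j) + ?V * ?X + ?V * (?q * ?Y) + ?V * ?Z"
  proof (intro add_mono)
    show "?V * (\<Sum>j=1..n. P n j * \<xi> j) \<le> ?V * ?X"
      using n big max_over_ge[of "{1..n}" n "\<lambda>j. \<Sum>i=1..j. P j i * \<xi> i"] by (intro mult_left_mono) auto
    have "(\<Sum>j=1..n. P n j) * ?Y\<^sup>2 \<le> (2 * t n powr \<alpha>) * ?Y\<^sup>2"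
      using sum_P_le[OF n(2)] by (rule mult_right_mono) simp
    also have "\<dots> = (?q * ?Y) * (?q * ?Y)"
      by (simp add: power2_eq_square)
    also have "\<dots> \<le> ?V * (?q * ?Y)"
      using Y Y0 by (rule mult_right_mono)
    finally show "(\<Sum>j=1..n. P n j) * ?Y\<^sup>2 \<le> ?V * (?q * ?Y)" .
    have nonneg: "0 \<le> (\<Sum>j=1..n. P n j * (\<zeta> j)\<^sup>2)"
      by (intro sum_nonneg mult_nonneg_nonneg Pn) auto
    have "sqrt (\<Sum>j=1..n. P n j * (\<zeta> j)\<^sup>2) \<le> ?Z"
      using n max_over_ge[of "{1..n}" n "\<lambda>j. sqrt (\<Sum>i=1..j. P j i * (\<zeta> i)\<^sup>2)"] by simp
    then have "(\<Sum>j=1..n. P n j * (\<zeta> j)\<^sup>2) \<le> ?Z\<^sup>2"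
      by (rule sqrt_le_D)
    also have "?Z\<^sup>2 = ?Z * ?Z"
      by (rule power2_eq_square)
    also have "\<dots> \<le> ?V * ?Z"
      using Z nn by (intro mult_right_mono)
    finally show "(\<Sum>j=1..n. P n j * (\<zeta> j)\<^sup>2) \<le> ?V * ?Z" .
  qed simp
  finally have "?V\<^sup>2 - (v 0)\<^sup>2 \<le> ?V * (?X + ?q * ?Y + ?Z + (\<Sum>j=1..n. P n j * ?s j))"
    by (simp only: distrib_left add_ac)
  moreover have "(v 0)\<^sup>2 \<le> ?V * v 0"
    unfolding power2_eq_square using max'[of 0] nn by (intro mult_right_mono) auto
  ultimately have "?V * ?V \<le> ?V * (data n + (\<Sum>j=1..n. P n j * ?s j))"
    unfolding data_def by (simp add: distrib_left power2_eq_square)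
  then show ?thesis using big(2) by simp
qed

text \<open>
  \<open>W j\<close> bounds all values up to level \<open>j\<close> that are already controlled. In the row \<open>j = n\<close> only
  \<open>lam n 0\<close> multiplies the unknown \<open>v n\<close>, and the rest is controlled by \<open>W (n - 1)\<close>. The
  assumption \<open>W (n - 1) \<le> R\<close> disposes of the case that \<open>v n\<close> does not exceed some earlier value.
\<close>
lemma gronwall_step:
  assumes n: "1 \<le> n" "n \<le> N"
    and W: "\<And>i j. i \<le> j \<Longrightarrow> j < n \<Longrightarrow> v i \<le> W j"
    and R: "W (n - 1) \<le> R"
      "C_delta \<delta> * (data n + \<Lambda> * ((\<Sum>j=1..n-1. P n j * W j) + P n n * W (n - 1))) \<le> R"
  shows "v n \<le> R"
proof (rule ccontr)
  assume "\<not> v n \<le> R"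
  then have nR: "R < v n" by simp
  have W0: "0 \<le> W j" if "j < n" for j
    using W[of 0 j] v_nonneg[of 0] that by simp
  have Pn: "0 \<le> P n j" if "j \<in> {1..n}" for j using P_nonneg[of j n] that n by auto
  define A where "A = (\<Sum>j=1..n-1. P n j * W j) + P n n * W (n - 1)"
  have A: "0 \<le> A"
    unfolding A_def using n by (intro add_nonneg_nonneg sum_nonneg mult_nonneg_nonneg Pn W0) auto
  have "v n \<le> data n + (\<Sum>j=1..n. P n j * (\<Sum>i=0..j. lam j (j - i) * v i))"
  proof (rule linearised_inequality[OF n])
    show "v i \<le> v n" if "i < n" for i
    proof -
      have "i \<le> n - 1" "n - 1 < n" using that by auto
      then show ?thesis using W[of i "n - 1"] R nR by simp
    qed
    show "0 < v n" using W0[of "n - 1"] R nR n by auto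
    have "data n \<le> data n + \<Lambda> * A" using A Lambda_pos by simp
    also have "\<dots> \<le> C_delta \<delta> * (data n + \<Lambda> * A)"
      using mult_right_mono[OF C_delta_ge_1, of "data n + \<Lambda> * A"] A Lambda_pos data_nonneg[OF n(2)] by simp
    finally show "data n \<le> v n" using R nR unfolding A_def by simp
  qed
  also have "(\<Sum>j=1..n. P n j * (\<Sum>i=0..j. lam j (j - i) * v i))
      = (\<Sum>j=1..n-1. P n j * (\<Sum>i=0..j. lam j (j - i) * v i)) + P n n * (\<Sum>i=0..n. lam n (n - i) * v i)"
    using n by (cases n) auto
  also have "(\<Sum>j=1..n-1. P n j * (\<Sum>i=0..j. lam j (j - i) * v i)) \<le> (\<Sum>j=1..n-1. P n j * (\<Lambda> * W j))"
    using n by (intro sum_mono mult_left_mono sum_lam_le Pn W W0) auto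
  also have "P n n * (\<Sum>i=0..n. lam n (n - i) * v i) \<le> v n / \<delta> + P n n * (\<Lambda> * W (n - 1))"
  proof -
    \<comment> \<open>The row sum bound is applied to v with its unknown entry at n replaced by 0.\<close>
    have "(\<Sum>i=0..n. lam n (n - i) * v i) = (\<Sum>i=0..n-1. lam n (n - i) * v i) + lam n 0 * v n"
      using n by (cases n) auto
    also have "(\<Sum>i=0..n-1. lam n (n - i) * v i) = (\<Sum>i=0..n-1. lam n (n - i) * (v(n := 0)) i)"
      using n by (intro sum.cong) auto
    also have "\<dots> = (\<Sum>i=0..n. lam n (n - i) * (v(n := 0)) i)"
      using n by (cases n) auto
    also have "\<dots> \<le> \<Lambda> * W (n - 1)"
      using n W W0 by (intro sum_lam_le) auto
    finally have "P n n * (\<Sum>i=0..n. lam n (n - i) * v i) \<le> P n n * (\<Lambda> * W (n - 1) + lam n 0 * v n)"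
      using Pn n by (intro mult_left_mono) auto
    also have "P n n * lam n 0 * v n \<le> 1 / \<delta> * v n"
      using n by (intro mult_right_mono P_diag_lam_le v_nonneg)
    then have "P n n * (\<Lambda> * W (n - 1) + lam n 0 * v n) \<le> v n / \<delta> + P n n * (\<Lambda> * W (n - 1))"
      by (simp add: algebra_simps)
    finally show ?thesis .
  qed
  finally have "v n \<le> data n + \<Lambda> * A + v n / \<delta>"
    unfolding A_def by (simp add: sum_distrib_left algebra_simps)
  then have "v n * (\<delta> - 1) \<le> \<delta> * (data n + \<Lambda> * A)"
    using delta by (simp add: field_simps)
  then have "v n \<le> C_delta \<delta> * (data n + \<Lambda> * A)"
    unfolding C_delta_def using delta by (simp add: field_simps)
  then show False using R nR unfolding A_def by simp
qed

text \<open>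
  The bounds at the earlier levels \<open>i\<close> are partial sums of degree \<open>i \<le> n - 1\<close>, so \<open>W\<close> can be
  taken of degree \<open>n - 1\<close>, and one step of the recursion makes it degree \<open>n\<close>. As \<open>n * \<alpha> \<le> 1\<close>, the
  discrete integral of this polynomial is available including \<open>j = n\<close>; \<open>W (n - 1)\<close> may therefore be
  replaced by \<open>W n\<close> in the last summand, which completes that sum.
\<close>
lemma discrete_gronwall_early:
  assumes "1 \<le> n" "n \<le> N" "real n * \<alpha> \<le> 1"
  shows "v n \<le> C_delta \<delta> * mittag_leffler_partial \<alpha> (Suc n) (C_delta \<delta> * \<Lambda> * t n powr \<alpha>) * data n"
  using assms
proof (induction n rule: less_induct)
  case (less n)
  let ?C = "C_delta \<delta>"
  let ?z = "\<lambda>i. ?C * \<Lambda> * t i powr \<alpha>"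
  let ?e = "mittag_leffler_partial \<alpha>"
  let ?W = "\<lambda>i. ?C * ?e n (?z i) * data n"
  note n = less.prems(1,2)
  have C: "1 \<le> ?C" "0 < ?C" using C_delta_ge_1 by auto
  have z: "0 \<le> ?z i" "?z i \<le> ?z j" if "i \<le> j" "j \<le> n" for i j
    using that n alpha C Lambda_pos by (auto intro!: mult_left_mono powr_mono2 t_nonneg t_mono)
  have W_mono: "?W i \<le> ?W j" if "i \<le> j" "j \<le> n" for i j
  proof (rule mult_right_mono[OF mult_left_mono])
    show "?e n (?z i) \<le> ?e n (?z j)"
      using that by (intro mittag_leffler_partial_mono[OF alpha(1) z]) auto
  qed (use C data_nonneg[OF n(2)] in auto)
  show ?case
  proof (rule gronwall_step[OF n, where W = ?W])
    fix i j assume ij: "i \<le> j" "j < n"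
    have "v i \<le> ?W i"
    proof (cases "i = 0")
      case True
      have "1 * 1 \<le> ?C * ?e n (?z 0)"
        using C z alpha n by (intro mult_mono mittag_leffler_partial_ge_1) auto
      then have "1 * data n \<le> ?W 0"
        using data_nonneg[OF n(2)] by (intro mult_right_mono) auto
      then show ?thesis using v_0_le_data[OF n(2)] True by simp
    next
      case False
      have "real i * \<alpha> \<le> real n * \<alpha>" using ij alpha by (intro mult_right_mono) auto
      then have "v i \<le> ?C * ?e (Suc i) (?z i) * data i"
        using less.IH[of i] less.prems ij False by auto
      also have "\<dots> \<le> ?C * ?e n (?z i) * data n"
      proof (rule mult_mono[OF mult_left_mono])
        show "?e (Suc i) (?z i) \<le> ?e n (?z i)"
          using ij by (intro mittag_leffler_partial_mono[OF alpha(1) z(1)]) auto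
        have "1 \<le> ?e n (?z i)"
          using ij n by (intro mittag_leffler_partial_ge_1[OF alpha(1) z(1)]) auto
        then show "0 \<le> ?C * ?e n (?z i)" using C by simp
      qed (use ij n C in \<open>auto intro: data_mono data_nonneg\<close>)
      finally show ?thesis .
    qed
    also have "\<dots> \<le> ?W j" using ij by (intro W_mono) auto
    finally show "v i \<le> ?W j" .
  next
    show "?W (n - 1) \<le> ?C * ?e (Suc n) (?z n) * data n"
    proof (rule mult_right_mono[OF mult_left_mono])
      show "?e n (?z (n - 1)) \<le> ?e (Suc n) (?z n)"
        by (intro mittag_leffler_partial_mono[OF alpha(1) z(1)[of "n - 1" n] z(2)[of "n - 1" n]]) auto
    qed (use C data_nonneg[OF n(2)] in auto)
    have "(\<Sum>j=1..n-1. P n j * ?W j) + P n n * ?W (n - 1) \<le> (\<Sum>j=1..n-1. P n j * ?W j) + P n n * ?W n"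
      using n P_nonneg[of n n] by (intro add_left_mono mult_left_mono W_mono) auto
    also have "\<dots> = (\<Sum>j=1..n. P n j * ?W j)"
      using n by (cases n) auto
    also have "\<dots> = ?C * data n * (\<Sum>j=1..n. P n j * ?e n (?z j))"
      by (simp add: sum_distrib_left mult_ac)
    finally have "data n + \<Lambda> * ((\<Sum>j=1..n-1. P n j * ?W j) + P n n * ?W (n - 1))
        \<le> data n + \<Lambda> * (?C * data n * (\<Sum>j=1..n. P n j * ?e n (?z j)))"
      using Lambda_pos by (intro add_left_mono mult_left_mono) auto
    also have "\<dots> = data n * (1 + ?C * \<Lambda> * (\<Sum>j=1..n. P n j * ?e n (?z j)))"
      by (simp add: algebra_simps)
    also have "\<dots> \<le> data n * ?e (Suc n) (?z n)"
      using n less.prems C Lambda_pos by (intro mult_left_mono sum_P_mittag_leffler_partial data_nonneg) auto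
    finally have "?C * (data n + \<Lambda> * ((\<Sum>j=1..n-1. P n j * ?W j) + P n n * ?W (n - 1)))
        \<le> ?C * (data n * ?e (Suc n) (?z n))"
      using C by (intro mult_left_mono) auto
    also have "\<dots> = ?C * ?e (Suc n) (?z n) * data n"
      by (simp only: mult_ac)
    finally show "?C * (data n + \<Lambda> * ((\<Sum>j=1..n-1. P n j * ?W j) + P n n * ?W (n - 1)))
        \<le> ?C * ?e (Suc n) (?z n) * data n" .
  qed
qed

lemma n_alpha_ge_1: "1 \<le> N \<Longrightarrow> 1 \<le> n_alpha \<alpha> N"
  unfolding n_alpha_def using alpha by (auto simp: le_nat_floor)

lemma n_alpha_mult_le: "n \<le> n_alpha \<alpha> N \<Longrightarrow> real n * \<alpha> \<le> 1"
proof -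
  assume "n \<le> n_alpha \<alpha> N"
  then have "real n \<le> 1 / \<alpha>"
    using alpha unfolding n_alpha_def by (simp add: le_nat_iff le_floor_iff)
  then show ?thesis using alpha by (simp add: field_simps)
qed

lemma ratio_nonneg: "j \<in> {n_alpha \<alpha> N + 1..n} \<Longrightarrow> n \<le> N \<Longrightarrow> 0 \<le> P j j / P j (j - 1)"
  using n_alpha_ge_1 by (intro P_ratio_nonneg) auto

lemma max_ratio_nonneg:
  "n \<le> N \<Longrightarrow> 0 \<le> max_over {n_alpha \<alpha> N + 1..n} (\<lambda>j. P j j / P j (j - 1))"
  using ratio_nonneg by (intro max_over_nonneg) auto

text \<open>For \<open>n \<le> n_alpha \<alpha> N\<close> the index range is empty, so the maximum is 0.\<close>
lemma Lambda_n_eq: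
  "Lambda_n \<alpha> t N \<Lambda> n = \<Lambda> * (1 + max_over {n_alpha \<alpha> N + 1..n} (\<lambda>j. P j j / P j (j - 1)))"
  by (simp add: Lambda_n_def max_over_def)

lemma Lambda_n_mono: "m \<le> n \<Longrightarrow> n \<le> N \<Longrightarrow> Lambda_n \<alpha> t N \<Lambda> m \<le> Lambda_n \<alpha> t N \<Lambda> n"
  unfolding Lambda_n_eq using Lambda_pos ratio_nonneg
  by (intro mult_left_mono add_left_mono max_over_subset) auto

lemma Lambda_n_pos: "n \<le> N \<Longrightarrow> 0 < Lambda_n \<alpha> t N \<Lambda> n"
  unfolding Lambda_n_eq using Lambda_pos max_ratio_nonneg[of n] by auto

text \<open>
  Beyond \<open>n_alpha\<close> the summand \<open>P n n * W (n - 1)\<close> is charged to \<open>P n (n - 1) * W (n - 1)\<close>, one of the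
  summands of \<open>\<Sum>j=1..n-1. P n j * W j\<close>. The bounds at earlier levels are first weakened to the larger
  constant \<open>Lambda_n\<close> of the level \<open>n\<close>, so that a single Mittag-Leffler function is summed.
\<close>
lemma discrete_gronwall:
  assumes "1 \<le> n" "n \<le> N"
  shows "v n \<le> C_delta \<delta> * mittag_leffler \<alpha> (C_delta \<delta> * Lambda_n \<alpha> t N \<Lambda> n * t n powr \<alpha>) * data n"
  using assms
proof (induction n rule: less_induct)
  case (less n)
  let ?C = "C_delta \<delta>" and ?L = "Lambda_n \<alpha> t N \<Lambda>"
  let ?E = "mittag_leffler \<alpha>"
  note n = less.prems
  have C: "1 \<le> ?C" "0 < ?C" using C_delta_ge_1 by auto
  have z: "0 \<le> ?C * ?L i * t i powr \<alpha>" "?C * ?L i * t i powr \<alpha> \<le> ?C * ?L n * t j powr \<alpha>"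
    "0 \<le> ?C * ?L n * t j powr \<alpha>" "?C * ?L n * t i powr \<alpha> \<le> ?C * ?L n * t j powr \<alpha>"
    if "i \<le> j" "j \<le> n" for i j
    using that n alpha C Lambda_n_pos[of i] Lambda_n_pos[of n]
    by (auto intro!: mult_mono powr_mono2 t_nonneg t_mono Lambda_n_mono)
  show ?case
  proof (cases "n \<le> n_alpha \<alpha> N")
    case True
    have "v n \<le> ?C * mittag_leffler_partial \<alpha> (Suc n) (?C * \<Lambda> * t n powr \<alpha>) * data n"
      using n True by (intro discrete_gronwall_early n_alpha_mult_le)
    also have "\<dots> \<le> ?C * ?E (?C * \<Lambda> * t n powr \<alpha>) * data n"
      using n C alpha Lambda_pos
      by (intro mult_right_mono mult_left_mono mittag_leffler_partial_le data_nonneg) auto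
    also have "\<Lambda> = ?L n" using True by (simp add: Lambda_n_def)
    finally show ?thesis .
  next
    case False
    then have n2: "2 \<le> n" using n_alpha_ge_1 n by auto
    let ?W = "\<lambda>i. ?C * ?E (?C * ?L n * t i powr \<alpha>) * data n"
    let ?r = "max_over {n_alpha \<alpha> N + 1..n} (\<lambda>j. P j j / P j (j - 1))"
    have W_mono: "?W i \<le> ?W j" if "i \<le> j" "j \<le> n" for i j
    proof (rule mult_right_mono[OF mult_left_mono])
      show "?E (?C * ?L n * t i powr \<alpha>) \<le> ?E (?C * ?L n * t j powr \<alpha>)"
        using that by (intro mittag_leffler_mono[OF alpha(1) z(3,4)]) auto
    qed (use C data_nonneg[OF n(2)] in auto)
    have Pn: "P n n \<le> ?r * P n (n - 1)"
    proof -
      have "P n n / P n (n - 1) \<le> ?r"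
        using False by (intro max_over_ge[of _ n "\<lambda>j. P j j / P j (j - 1)"]) auto
      then show ?thesis using P_subdiag_pos[OF n2 n(2)] by (simp add: field_simps)
    qed
    show ?thesis
    proof (rule gronwall_step[OF n, where W = ?W])
      fix i j assume ij: "i \<le> j" "j < n"
      have "v i \<le> ?W i"
      proof (cases "i = 0")
        case True
        have "1 * 1 \<le> ?C * ?E (?C * ?L n * t 0 powr \<alpha>)"
          using C z(3)[of 0 0] alpha by (intro mult_mono mittag_leffler_ge_1) auto
        then have "1 * data n \<le> ?W 0"
          using data_nonneg[OF n(2)] by (intro mult_right_mono) auto
        then show ?thesis using v_0_le_data[OF n(2)] True by simp
      next
        case False
        then have "v i \<le> ?C * ?E (?C * ?L i * t i powr \<alpha>) * data i"
          using less.IH[of i] n ij by auto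
        also have "\<dots> \<le> ?W i"
        proof (rule mult_mono[OF mult_left_mono])
          show "?E (?C * ?L i * t i powr \<alpha>) \<le> ?E (?C * ?L n * t i powr \<alpha>)"
            using ij by (intro mittag_leffler_mono[OF alpha(1) z(1,2)]) auto
          have "1 \<le> ?E (?C * ?L n * t i powr \<alpha>)"
            using ij by (intro mittag_leffler_ge_1[OF alpha(1) z(3)]) auto
          then show "0 \<le> ?C * ?E (?C * ?L n * t i powr \<alpha>)" using C by simp
        qed (use ij n C in \<open>auto intro: data_mono data_nonneg\<close>)
        finally show ?thesis .
      qed
      also have "\<dots> \<le> ?W j" using ij by (intro W_mono) auto
      finally show "v i \<le> ?W j" .
    next
      show "?W (n - 1) \<le> ?W n" by (intro W_mono) auto
      let ?S = "\<Sum>j=1..n-1. P n j * ?W j"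
      have W0: "0 \<le> ?W j" if "j \<le> n" for j
        using that C data_nonneg[OF n(2)] z(3)[of j j] alpha mittag_leffler_ge_1[of \<alpha> "?C * ?L n * t j powr \<alpha>"]
        by (intro mult_nonneg_nonneg) auto
      have "P n n * ?W (n - 1) \<le> ?r * P n (n - 1) * ?W (n - 1)"
        by (intro mult_right_mono Pn W0) auto
      also have "P n (n - 1) * ?W (n - 1) \<le> ?S"
        using n n2 by (intro member_le_sum[of "n - 1" _ "\<lambda>j. P n j * ?W j"] mult_nonneg_nonneg P_nonneg W0) auto
      then have "?r * P n (n - 1) * ?W (n - 1) \<le> ?r * ?S"
        using max_ratio_nonneg[OF n(2)] by (simp only: mult.assoc mult_left_mono)
      finally have "data n + \<Lambda> * (?S + P n n * ?W (n - 1)) \<le> data n + \<Lambda> * (?S + ?r * ?S)"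
        using Lambda_pos by (intro add_left_mono mult_left_mono) auto
      also have "\<Lambda> * (?S + ?r * ?S) = ?L n * ?S"
        unfolding Lambda_n_eq by (simp only: distrib_left distrib_right mult_1_left mult_1_right mult.assoc)
      also have "?L n * ?S = ?L n * (?C * data n * (\<Sum>j=1..n-1. P n j * ?E (?C * ?L n * t j powr \<alpha>)))"
        by (simp add: sum_distrib_left mult_ac)
      also have "data n + ?L n * (?C * data n * (\<Sum>j=1..n-1. P n j * ?E (?C * ?L n * t j powr \<alpha>)))
          = data n * (1 + ?C * ?L n * (\<Sum>j=1..n-1. P n j * ?E (?C * ?L n * t j powr \<alpha>)))"
        by (simp only: distrib_left mult_1_right mult_ac)
      also have "\<dots> \<le> data n * ?E (?C * ?L n * t n powr \<alpha>)"
        using n C Lambda_n_pos[OF n(2)] by (intro mult_left_mono sum_P_mittag_leffler graded data_nonneg) auto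
      finally have "?C * (data n + \<Lambda> * (?S + P n n * ?W (n - 1)))
          \<le> ?C * (data n * ?E (?C * ?L n * t n powr \<alpha>))"
        using C by (intro mult_left_mono) auto
      also have "\<dots> = ?W n"
        by (simp only: mult_ac)
      finally show "?C * (data n + \<Lambda> * (?S + P n n * ?W (n - 1))) \<le> ?W n" .
    qed
  qed
qed

lemma Lambda_n_le:
  assumes "n \<le> N"
  shows "Lambda_n \<alpha> t N \<Lambda> n \<le> \<Lambda> * (1 + max_over {n_alpha \<alpha> N + 1..n} (\<lambda>j. mu t j powr \<alpha> / \<alpha>))"
  unfolding Lambda_n_eq
proof (intro mult_left_mono add_left_mono max_over_least)
  fix j assume j: "j \<in> {n_alpha \<alpha> N + 1..n}"
  have "P j j / P j (j - 1) \<le> mu t j powr \<alpha> / \<alpha>"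
    using j assms n_alpha_ge_1 by (intro P_ratio_le) auto
  also have "\<dots> \<le> max_over {n_alpha \<alpha> N + 1..n} (\<lambda>j. mu t j powr \<alpha> / \<alpha>)"
    using j by (intro max_over_ge[of _ j "\<lambda>j. mu t j powr \<alpha> / \<alpha>"]) auto
  finally show "P j j / P j (j - 1) \<le> max_over {n_alpha \<alpha> N + 1..n} (\<lambda>j. mu t j powr \<alpha> / \<alpha>)" .
qed (use Lambda_pos alpha in \<open>auto intro!: max_over_nonneg\<close>)

end

theorem lemma3p3:
  fixes \<alpha> T \<Lambda> \<delta> :: real
    and N :: nat
    and t v \<xi> \<eta> \<zeta> :: "nat \<Rightarrow> real"
    and lam :: "nat \<Rightarrow> nat \<Rightarrow> real"  (* lam n j is $\lambda_j^n$ *)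
  assumes "0 < \<alpha>" "\<alpha> < 1"
    and "0 < T"
    and "tgrid t N T"
    and "\<forall>n\<in>{0..N}. 0 \<le> v n"
    and "\<forall>n\<in>{1..N}. 0 \<le> \<xi> n \<and> 0 \<le> \<eta> n \<and> 0 \<le> \<zeta> n"
    and "\<forall>n\<in>{1..N}. \<forall>j\<in>{0..n}. 0 \<le> lam n j"
    and "\<forall>n\<in>{1..N}. L1_deriv \<alpha> t (\<lambda>i. (v i)\<^sup>2) n
           \<le> (\<Sum>i=0..n. lam n (n - i) * (v i)\<^sup>2) + v n * \<xi> n + (\<eta> n)\<^sup>2 + (\<zeta> n)\<^sup>2"
    and "0 < \<Lambda>"
    and "\<forall>n\<in>{1..N}. (\<Sum>j=0..n. lam n j) \<le> \<Lambda>"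
    and "\<forall>n\<in>{2..N}. tstep t (n - 1) \<le> tstep t n"
    and "1 < \<delta>"
    and "max_over {1..N} (\<lambda>n. lam n 0) = 0 \<or>
         max_over {1..N} (tstep t)
           \<le> (\<delta> * Gamma (2 - \<alpha>) * max_over {1..N} (\<lambda>n. lam n 0)) powr (- 1 / \<alpha>)"
  shows
    "(\<forall>n\<in>{1..N}.
        v n \<le> C_delta \<delta>
               * mittag_leffler \<alpha> (C_delta \<delta> * Lambda_n \<alpha> t N \<Lambda> n * t n powr \<alpha>)
               * (v 0
                  + max_over {1..n} (\<lambda>j. \<Sum>i=1..j. Pker \<alpha> t j i * \<xi> i)
                  + sqrt (2 * t n powr \<alpha>) * max_over {1..n} \<eta>
                  + max_over {1..n} (\<lambda>j. sqrt (\<Sum>i=1..j. Pker \<alpha> t j i * (\<zeta> i)\<^sup>2))))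
     \<and> (\<forall>n\<in>{1..N}.
          Lambda_n \<alpha> t N \<Lambda> n
            \<le> \<Lambda> * (1 + max_over {n_alpha \<alpha> N + 1..n} (\<lambda>j. mu t j powr \<alpha> / \<alpha>)))"
proof -
  interpret L1_gronwall \<alpha> t N v \<xi> \<eta> \<zeta> lam \<Lambda> \<delta>
    using assms by unfold_locales (simp_all add: tgrid_def)
  show ?thesis
    using discrete_gronwall Lambda_n_le by (auto simp: data_def)
qed

end
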